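(* Let $\alpha=\frac{1+\sqrt5}{2}$. The linear space $\mathcal{QT}$ of all Quasi-Toeplitz matrices $A=T(a)+E$, endowed with the usual sum and product of semi-infinite matrices and with the norm $$\|A\|_{\mathcal{QT}}=\alpha\|a\|_{\mathcal W}+\|E\|_2 ,$$ is a Banach algebra; that is, $\mathcal{QT}$ is closed under matrix multiplication, it is complete with respect to $\|\cdot\|_{\mathcal{QT}}$, and $\|AB\|_{\mathcal{QT}}\le\|A\|_{\mathcal{QT}}\|B\|_{\mathcal{QT}}$ for all $A,B\in\mathcal{QT}$.
   Context: The Wiener class $\mathcal W$ is the set of functions $a(z)=\sum_{i\in\mathbb Z}a_iz^i$ on the complex unit circle $\{|z|=1\}$ with complex coefficients such that $\|a\|_{\mathcal W}:=\sum_{i\in\mathbb Z}|a_i|<\infty$. For $a\in\mathcal W$, $T(a)=(a_{j-i})_{i,j\ge 1}$ is the associated semi-infinite Toeplitz matrix, which defines a bounded operator on $\ell^2=\ell^2(\mathbb Z^+)$. A semi-infinite matrix $A$ is Quasi-Toeplitz (QT) if it can be written as $A=T(a)+E$ with $a\in\mathcal W$ and $E=(e_{i,j})_{i,j\ge1}$ defining a compact operator on $\ell^2$ (such a decomposition is unique). $\|E\|_2$ denotes the operator norm induced by the $\ell^2$ norm. A Banach algebra here is a complete normed algebra with sub-multiplicative norm (the norm of the identity is not required to be $1$). *)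

theory Defs
  imports "HOL-Analysis.Analysis" "HOL-Library.Function_Algebras"
begin

section \<open>The Hilbert space of square-summable complex sequences\<close>

text \<open>Indices start at 0 instead of 1, for sequences and for matrices alike.\<close>

typedef ell2 = "{x :: nat \<Rightarrow> complex. summable (\<lambda>n. (cmod (x n))\<^sup>2)}"
  morphisms ell2_nth Abs_ell2
  by (rule exI[of _ "\<lambda>_. 0"]) simp

setup_lifting type_definition_ell2

lemma ell2_summable: "summable (\<lambda>n. (cmod (ell2_nth x n))\<^sup>2)"
  using ell2_nth[of x] by simp

lemma square_summable_add:
  fixes x y :: "nat \<Rightarrow> complex"
  assumes "summable (\<lambda>n. (cmod (x n))\<^sup>2)" "summable (\<lambda>n. (cmod (y n))\<^sup>2)"
  shows "summable (\<lambda>n. (cmod (x n + y n))\<^sup>2)"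
proof (rule summable_comparison_test')
  show "summable (\<lambda>n. 2 * (cmod (x n))\<^sup>2 + 2 * (cmod (y n))\<^sup>2)"
    using assms by (intro summable_add summable_mult)
  fix n :: nat
  have "(cmod (x n + y n))\<^sup>2 \<le> (cmod (x n) + cmod (y n))\<^sup>2"
    by (intro power_mono norm_triangle_ineq) auto
  also have "\<dots> \<le> 2 * (cmod (x n))\<^sup>2 + 2 * (cmod (y n))\<^sup>2"
    using zero_le_power2[of "cmod (x n) - cmod (y n)"]
    by (simp add: power2_eq_square algebra_simps)
  finally show "norm ((cmod (x n + y n))\<^sup>2) \<le> 2 * (cmod (x n))\<^sup>2 + 2 * (cmod (y n))\<^sup>2"
    by simp
qed

lemma summable_inner_ell2: "summable (\<lambda>n. ell2_nth x n \<bullet> ell2_nth y n)"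
proof (rule summable_comparison_test')
  show "summable (\<lambda>n. (cmod (ell2_nth x n))\<^sup>2 + (cmod (ell2_nth y n))\<^sup>2)"
    by (intro summable_add ell2_summable)
  fix n :: nat
  have "\<bar>ell2_nth x n \<bullet> ell2_nth y n\<bar> \<le> cmod (ell2_nth x n) * cmod (ell2_nth y n)"
    by (rule Cauchy_Schwarz_ineq2)
  also have "\<dots> \<le> (cmod (ell2_nth x n))\<^sup>2 + (cmod (ell2_nth y n))\<^sup>2"
    using zero_le_power2[of "cmod (ell2_nth x n) - cmod (ell2_nth y n)"]
      zero_le_power2[of "cmod (ell2_nth x n)"] zero_le_power2[of "cmod (ell2_nth y n)"]
    unfolding power2_diff by linarith
  finally show "norm (ell2_nth x n \<bullet> ell2_nth y n)
      \<le> (cmod (ell2_nth x n))\<^sup>2 + (cmod (ell2_nth y n))\<^sup>2" by simp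
qed

instantiation ell2 :: real_vector
begin

lift_definition zero_ell2 :: ell2 is "\<lambda>_. 0" by simp

lift_definition plus_ell2 :: "ell2 \<Rightarrow> ell2 \<Rightarrow> ell2" is "\<lambda>x y n. x n + y n"
  by (rule square_summable_add)

lift_definition uminus_ell2 :: "ell2 \<Rightarrow> ell2" is "\<lambda>x n. - x n" by simp

lift_definition minus_ell2 :: "ell2 \<Rightarrow> ell2 \<Rightarrow> ell2" is "\<lambda>x y n. x n - y n"
  subgoal for x y using square_summable_add[of x "\<lambda>n. - y n"] by simp
  done

lift_definition scaleR_ell2 :: "real \<Rightarrow> ell2 \<Rightarrow> ell2" is "\<lambda>r x n. r *\<^sub>R x n"
  by (simp add: power_mult_distrib summable_mult)

instance
  by standard (transfer; auto simp: fun_eq_iff algebra_simps)+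

end

instantiation ell2 :: real_inner
begin

definition inner_ell2 :: "ell2 \<Rightarrow> ell2 \<Rightarrow> real"
  where "inner_ell2 x y = (\<Sum>n. ell2_nth x n \<bullet> ell2_nth y n)"

definition norm_ell2 :: "ell2 \<Rightarrow> real"
  where "norm_ell2 x = sqrt (\<Sum>n. (cmod (ell2_nth x n))\<^sup>2)"

definition sgn_ell2 :: "ell2 \<Rightarrow> ell2"
  where "sgn_ell2 x = x /\<^sub>R norm x"

definition dist_ell2 :: "ell2 \<Rightarrow> ell2 \<Rightarrow> real"
  where "dist_ell2 x y = norm (x - y)"

definition uniformity_ell2 :: "(ell2 \<times> ell2) filter"
  where "uniformity_ell2 = (INF e\<in>{0 <..}. principal {(x, y). dist x y < e})"

definition open_ell2 :: "ell2 set \<Rightarrow> bool"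
  where "open_ell2 U \<longleftrightarrow> (\<forall>x\<in>U. \<forall>\<^sub>F (x', y) in uniformity. x' = x \<longrightarrow> y \<in> U)"

instance
proof
  fix x y z :: ell2 and r :: real and U :: "ell2 set"
  show "dist x y = norm (x - y)" by (rule dist_ell2_def)
  show "sgn x = x /\<^sub>R norm x" by (rule sgn_ell2_def)
  show "uniformity = (INF e\<in>{0 <..}. principal {(x :: ell2, y). dist x y < e})"
    by (rule uniformity_ell2_def)
  show "open U \<longleftrightarrow> (\<forall>x\<in>U. \<forall>\<^sub>F (x', y) in uniformity. x' = x \<longrightarrow> y \<in> U)"
    by (rule open_ell2_def)
  show "x \<bullet> y = y \<bullet> x"
    unfolding inner_ell2_def by (simp add: inner_commute)
  show "(x + y) \<bullet> z = x \<bullet> z + y \<bullet> z"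
    unfolding inner_ell2_def
    by (simp add: plus_ell2.rep_eq inner_add_left suminf_add[OF summable_inner_ell2 summable_inner_ell2])
  show "(r *\<^sub>R x) \<bullet> y = r * (x \<bullet> y)"
    unfolding inner_ell2_def
    by (simp add: scaleR_ell2.rep_eq suminf_mult[OF summable_inner_ell2])
  show "0 \<le> x \<bullet> x"
    unfolding inner_ell2_def by (intro suminf_nonneg summable_inner_ell2) simp
  show "x \<bullet> x = 0 \<longleftrightarrow> x = 0"
  proof -
    have "x \<bullet> x = 0 \<longleftrightarrow> (\<forall>n. ell2_nth x n \<bullet> ell2_nth x n = 0)"
      unfolding inner_ell2_def
      by (intro suminf_eq_zero_iff summable_inner_ell2) simp
    then show ?thesis
      by (simp add: zero_ell2.rep_eq fun_eq_iff flip: ell2_nth_inject)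
  qed
  show "norm x = sqrt (x \<bullet> x)"
    unfolding norm_ell2_def inner_ell2_def by (simp add: power2_norm_eq_inner)
qed

end


section \<open>Semi-infinite matrices\<close>

type_synonym inf_mat = "nat \<Rightarrow> nat \<Rightarrow> complex"

text \<open>Addition, subtraction and zero of matrices are the entrywise ones of
  \<^theory>\<open>HOL-Library.Function_Algebras\<close>. The entrywise product and unit of that
  theory are not the ones of matrices, hence the following definitions.\<close>

definition mat_scale :: "complex \<Rightarrow> inf_mat \<Rightarrow> inf_mat"
  where "mat_scale c A = (\<lambda>i j. c * A i j)"

definition mat_mult :: "inf_mat \<Rightarrow> inf_mat \<Rightarrow> inf_mat"
  where "mat_mult A B = (\<lambda>i j. \<Sum>k. A i k * B k j)"

definition mat_one :: inf_mat
  where "mat_one = (\<lambda>i j. if i = j then 1 else 0)"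

text \<open>This is meaningful only for matrices satisfying \<open>bounded_mat\<close> below.\<close>

definition mat_op :: "inf_mat \<Rightarrow> ell2 \<Rightarrow> ell2"
  where "mat_op A x = Abs_ell2 (\<lambda>i. \<Sum>j. A i j * ell2_nth x j)"

definition bounded_mat :: "inf_mat \<Rightarrow> bool"
  where "bounded_mat A \<longleftrightarrow>
    (\<forall>x. (\<forall>i. summable (\<lambda>j. A i j * ell2_nth x j)) \<and>
         summable (\<lambda>i. (cmod (\<Sum>j. A i j * ell2_nth x j))\<^sup>2)) \<and>
    bounded_linear (mat_op A)"

definition compact_mat :: "inf_mat \<Rightarrow> bool"
  where "compact_mat A \<longleftrightarrow> bounded_mat A \<and> compact (closure (mat_op A ` ball 0 1))"


section \<open>Wiener class and quasi-Toeplitz matrices\<close>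

definition wiener_expansion :: "(int \<Rightarrow> complex) \<Rightarrow> (complex \<Rightarrow> complex) \<Rightarrow> bool"
  where "wiener_expansion c a \<longleftrightarrow>
    (\<lambda>i. cmod (c i)) summable_on UNIV \<and>
    (\<forall>z\<in>sphere 0 1. ((\<lambda>i. c i * z powi i) has_sum a z) UNIV)"

text \<open>Functions on the unit circle are represented by total functions with the fixed
  value \<^const>\<open>undefined\<close> off the circle.\<close>

definition wiener_class :: "(complex \<Rightarrow> complex) set"
  where "wiener_class = {a \<in> extensional (sphere 0 1). \<exists>c. wiener_expansion c a}"

text \<open>The coefficient family is unique, since it consists of the Fourier coefficients of
  the function.\<close>

definition wiener_coeff :: "(complex \<Rightarrow> complex) \<Rightarrow> int \<Rightarrow> complex"
  where "wiener_coeff a = (THE c. wiener_expansion c a)"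

definition wiener_norm :: "(complex \<Rightarrow> complex) \<Rightarrow> real"
  where "wiener_norm a = (\<Sum>\<^sub>\<infinity>i. cmod (wiener_coeff a i))"

definition toeplitz :: "(complex \<Rightarrow> complex) \<Rightarrow> inf_mat"
  where "toeplitz a = (\<lambda>i j. wiener_coeff a (int j - int i))"

definition qt_decomp :: "inf_mat \<Rightarrow> (complex \<Rightarrow> complex) \<Rightarrow> inf_mat \<Rightarrow> bool"
  where "qt_decomp A a E \<longleftrightarrow> a \<in> wiener_class \<and> compact_mat E \<and> A = toeplitz a + E"

definition QT :: "inf_mat set"
  where "QT = {A. \<exists>a E. qt_decomp A a E}"

text \<open>The decomposition of a quasi-Toeplitz matrix is unique, so its norm is well defined.\<close>

definition qt_norm :: "real \<Rightarrow> inf_mat \<Rightarrow> real"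
  where "qt_norm \<alpha> A =
    (THE r. \<exists>a E. qt_decomp A a E \<and> r = \<alpha> * wiener_norm a + onorm (mat_op E))"


section \<open>Banach algebras on a carrier set\<close>

text \<open>The algebra is unital, but nothing is required of the norm of the unit.\<close>

locale banach_algebra_on = vector_space scale
  for scale :: "complex \<Rightarrow> 'a::ab_group_add \<Rightarrow> 'a" +
  fixes S :: "'a set"
    and mult :: "'a \<Rightarrow> 'a \<Rightarrow> 'a"
    and one :: 'a
    and nrm :: "'a \<Rightarrow> real"
  assumes subspace_carrier: "subspace S"
    and mult_closed: "\<And>x y. x \<in> S \<Longrightarrow> y \<in> S \<Longrightarrow> mult x y \<in> S"
    and mult_assoc: "\<And>x y z. x \<in> S \<Longrightarrow> y \<in> S \<Longrightarrow> z \<in> S \<Longrightarrow>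
      mult (mult x y) z = mult x (mult y z)"
    and mult_add_left: "\<And>x y z. x \<in> S \<Longrightarrow> y \<in> S \<Longrightarrow> z \<in> S \<Longrightarrow>
      mult (x + y) z = mult x z + mult y z"
    and mult_add_right: "\<And>x y z. x \<in> S \<Longrightarrow> y \<in> S \<Longrightarrow> z \<in> S \<Longrightarrow>
      mult x (y + z) = mult x y + mult x z"
    and mult_scale_left: "\<And>c x y. x \<in> S \<Longrightarrow> y \<in> S \<Longrightarrow>
      mult (scale c x) y = scale c (mult x y)"
    and mult_scale_right: "\<And>c x y. x \<in> S \<Longrightarrow> y \<in> S \<Longrightarrow>
      mult x (scale c y) = scale c (mult x y)"
    and one_closed: "one \<in> S"
    and mult_one_left: "\<And>x. x \<in> S \<Longrightarrow> mult one x = x"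
    and mult_one_right: "\<And>x. x \<in> S \<Longrightarrow> mult x one = x"
    and nrm_nonneg: "\<And>x. x \<in> S \<Longrightarrow> 0 \<le> nrm x"
    and nrm_eq_0_iff: "\<And>x. x \<in> S \<Longrightarrow> nrm x = 0 \<longleftrightarrow> x = 0"
    and nrm_scale: "\<And>c x. x \<in> S \<Longrightarrow> nrm (scale c x) = cmod c * nrm x"
    and nrm_triangle: "\<And>x y. x \<in> S \<Longrightarrow> y \<in> S \<Longrightarrow> nrm (x + y) \<le> nrm x + nrm y"
    and nrm_mult: "\<And>x y. x \<in> S \<Longrightarrow> y \<in> S \<Longrightarrow> nrm (mult x y) \<le> nrm x * nrm y"
    and nrm_complete: "\<And>X. range X \<subseteq> S \<Longrightarrow>
      (\<forall>e>0. \<exists>N. \<forall>m\<ge>N. \<forall>n\<ge>N. nrm (X m - X n) < e) \<Longrightarrow>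
      \<exists>x\<in>S. (\<lambda>n::nat. nrm (X n - x)) \<longlonglongrightarrow> 0"

end

theory Submission
  imports Defs
begin

text \<open>
A product of two quasi-Toeplitz matrices is computed from the classical identity
\<open>T(a) T(b) = T(ab) - H(a\<^sup>-) H(b\<^sup>+)\<close> (\<open>toeplitz_op_compose\<close>), in which the two factors of the
correction are Hankel matrices formed from the coefficients of \<open>a\<close> with negative index and of
\<open>b\<close> with positive index. A Hankel matrix of an absolutely summable family is a norm convergent
series of finite rank operators, so it is compact and its norm is at most the sum of the
absolute values; a Toeplitz matrix is likewise bounded by the Wiener norm of its symbol.
Hence, for \<open>A = T(a) + E\<close> and \<open>B = T(b) + F\<close>, the matrix \<open>AB\<close> is \<open>T(ab)\<close> plus a compact matrix
of norm at most \<open>pq + p \<parallel>F\<parallel> + \<parallel>E\<parallel> q + \<parallel>E\<parallel> \<parallel>F\<parallel>\<close>, where \<open>p\<close> and \<open>q\<close> are the Wiener norms of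
\<open>a\<close> and \<open>b\<close>. Comparing \<open>\<alpha> pq\<close> plus this bound with \<open>(\<alpha> p + \<parallel>E\<parallel>) (\<alpha> q + \<parallel>F\<parallel>)\<close> leaves the
conditions \<open>\<alpha> + 1 \<le> \<alpha>\<^sup>2\<close> and \<open>1 \<le> \<alpha>\<close>; the golden ratio satisfies the first with equality
(\<open>qt_norm_submultiplicative\<close>).

The norm is well defined, since the entries of a compact matrix tend to zero along each
diagonal while those of a Toeplitz matrix are constant (\<open>toeplitz_plus_compact_unique\<close>), and
since a function in the Wiener class determines its coefficients (\<open>wiener_expansion_unique\<close>).
Thus the quasi-Toeplitz matrices form a weighted direct sum of the space of absolutely
summable families and the space of compact operators. The former is complete
(\<open>ell1_complete\<close>), the latter is a closed subspace of the Banach space of bounded operators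
(\<open>closed_compact_linear_ops\<close>), and completeness follows (\<open>qt_norm_complete\<close>).

Matrices are translated to operators by \<open>compact_mat_iff\<close> and \<open>mat_mult_matrix_of\<close>; the
algebraic laws of matrix multiplication then become those of composition.
\<close>


section \<open>Completeness of the sequence space\<close>

lemma norm_ell2_power2: "(norm x)\<^sup>2 = (\<Sum>n. (cmod (ell2_nth x n))\<^sup>2)"
  unfolding norm_ell2_def
  by (intro real_sqrt_pow2 suminf_nonneg ell2_summable) simp

lemma norm_ell2_le_iff:
  assumes "0 \<le> r"
  shows "norm x \<le> r \<longleftrightarrow> (\<forall>N. (\<Sum>n<N. (cmod (ell2_nth x n))\<^sup>2) \<le> r\<^sup>2)"
proof -
  have "norm x \<le> r \<longleftrightarrow> (norm x)\<^sup>2 \<le> r\<^sup>2"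
    using abs_le_square_iff[of "norm x" r] assms by simp
  also have "\<dots> \<longleftrightarrow> (\<forall>N. (\<Sum>n<N. (cmod (ell2_nth x n))\<^sup>2) \<le> r\<^sup>2)"
    unfolding norm_ell2_power2
  proof safe
    fix N
    assume *: "(\<Sum>n. (cmod (ell2_nth x n))\<^sup>2) \<le> r\<^sup>2"
    have "(\<Sum>n<N. (cmod (ell2_nth x n))\<^sup>2) \<le> (\<Sum>n. (cmod (ell2_nth x n))\<^sup>2)"
      by (intro sum_le_suminf ell2_summable) auto
    with * show "(\<Sum>n<N. (cmod (ell2_nth x n))\<^sup>2) \<le> r\<^sup>2" by linarith
  next
    assume "\<forall>N. (\<Sum>n<N. (cmod (ell2_nth x n))\<^sup>2) \<le> r\<^sup>2"
    then show "(\<Sum>n. (cmod (ell2_nth x n))\<^sup>2) \<le> r\<^sup>2"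
      by (intro suminf_le_const ell2_summable) auto
  qed
  finally show ?thesis .
qed

lemma cmod_ell2_nth_le_norm: "cmod (ell2_nth x n) \<le> norm x"
proof -
  have "(cmod (ell2_nth x n))\<^sup>2 \<le> (\<Sum>k<Suc n. (cmod (ell2_nth x k))\<^sup>2)"
    by (simp add: sum_nonneg)
  also have "\<dots> \<le> (norm x)\<^sup>2"
    using norm_ell2_le_iff[OF norm_ge_zero, of x x] by blast
  finally show ?thesis
    by (rule power2_le_imp_le) simp
qed

lemma ell2_eqI: "(\<And>n. ell2_nth x n = ell2_nth y n) \<Longrightarrow> x = y"
  by (simp add: fun_eq_iff flip: ell2_nth_inject)

lemma ell2_nth_Abs:
  "summable (\<lambda>n. (cmod (f n))\<^sup>2) \<Longrightarrow> ell2_nth (Abs_ell2 f) = f"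
  by (simp add: Abs_ell2_inverse)

lemma square_summable_bounded_sums:
  assumes "\<And>N. (\<Sum>n<N. (cmod (f n))\<^sup>2) \<le> r"
  shows "summable (\<lambda>n. (cmod (f n))\<^sup>2)"
  by (rule summableI_nonneg_bounded[of _ r]) (use assms in auto)

lemma bounded_linear_ell2_nth: "bounded_linear (\<lambda>x. ell2_nth x n)"
  by (rule bounded_linear_intro[of _ 1])
    (auto simp: plus_ell2.rep_eq scaleR_ell2.rep_eq cmod_ell2_nth_le_norm)

instance ell2 :: banach
proof
  fix X :: "nat \<Rightarrow> ell2"
  assume X: "Cauchy X"
  have "Cauchy (\<lambda>k. ell2_nth (X k) n)" for n
    by (rule bounded_linear.Cauchy[OF bounded_linear_ell2_nth X])
  then have "\<forall>n. \<exists>l. (\<lambda>k. ell2_nth (X k) n) \<longlonglongrightarrow> l"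
    using Cauchy_convergent_iff convergent_def by blast
  then obtain y where y: "\<And>n. (\<lambda>k. ell2_nth (X k) n) \<longlonglongrightarrow> y n" by metis
  have tail: "\<exists>K. \<forall>k\<ge>K. \<forall>N. (\<Sum>n<N. (cmod (ell2_nth (X k) n - y n))\<^sup>2) \<le> e\<^sup>2"
    if e: "0 < e" for e
  proof -
    from CauchyD[OF X e] obtain K where K: "\<And>k l. K \<le> k \<Longrightarrow> K \<le> l \<Longrightarrow> norm (X k - X l) < e" by blast
    have "(\<Sum>n<N. (cmod (ell2_nth (X k) n - y n))\<^sup>2) \<le> e\<^sup>2" if k: "K \<le> k" for k N
    proof (rule LIMSEQ_le_const2)
      show "(\<lambda>l. \<Sum>n<N. (cmod (ell2_nth (X k) n - ell2_nth (X l) n))\<^sup>2)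
          \<longlonglongrightarrow> (\<Sum>n<N. (cmod (ell2_nth (X k) n - y n))\<^sup>2)"
        by (intro tendsto_intros y)
      have "(\<Sum>n<N. (cmod (ell2_nth (X k) n - ell2_nth (X l) n))\<^sup>2) \<le> e\<^sup>2" if "K \<le> l" for l
        using norm_ell2_le_iff[of e "X k - X l"] K[OF k that] e
        by (simp add: minus_ell2.rep_eq)
      then show "\<exists>K. \<forall>l\<ge>K. (\<Sum>n<N. (cmod (ell2_nth (X k) n - ell2_nth (X l) n))\<^sup>2) \<le> e\<^sup>2"
        by blast
    qed
    then show ?thesis by blast
  qed
  have diff: "summable (\<lambda>n. (cmod (ell2_nth (X k) n - y n))\<^sup>2)"
    if "\<forall>N. (\<Sum>n<N. (cmod (ell2_nth (X k) n - y n))\<^sup>2) \<le> e\<^sup>2" for k e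
    using that by (intro square_summable_bounded_sums) blast
  from tail[of 1] obtain k where "\<forall>N. (\<Sum>n<N. (cmod (ell2_nth (X k) n - y n))\<^sup>2) \<le> 1\<^sup>2" by auto
  from diff[OF this] have "summable (\<lambda>n. (cmod (y n - ell2_nth (X k) n))\<^sup>2)"
    by (simp add: norm_minus_commute)
  from square_summable_add[OF this ell2_summable[of "X k"]]
  have y_mem: "summable (\<lambda>n. (cmod (y n))\<^sup>2)" by simp
  have "X \<longlonglongrightarrow> Abs_ell2 y"
  proof (rule LIMSEQ_I)
    fix e :: real
    assume "0 < e"
    then obtain K where K: "\<forall>k\<ge>K. \<forall>N. (\<Sum>n<N. (cmod (ell2_nth (X k) n - y n))\<^sup>2) \<le> (e/2)\<^sup>2"
      using tail[of "e/2"] by auto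
    have "norm (X k - Abs_ell2 y) \<le> e/2" if "K \<le> k" for k
      using K that \<open>0 < e\<close>
      by (subst norm_ell2_le_iff) (auto simp: minus_ell2.rep_eq ell2_nth_Abs[OF y_mem])
    then show "\<exists>K. \<forall>k\<ge>K. norm (X k - Abs_ell2 y) < e"
      using \<open>0 < e\<close> by (intro exI[of _ K]) force
  qed
  then show "convergent X" by (auto simp: convergent_def)
qed


section \<open>Matrices as operators\<close>

text \<open>A bounded matrix is the matrix, in the standard basis, of a bounded operator that also
commutes with complex scalars; conversely every such operator has a bounded matrix. All
later arguments take place in the Banach space of bounded operators on the sequence space,
whose elements are a priori only real-linear, so that complex linearity is carried along as
a separate closed condition.\<close>
lift_definition basis_ell2 :: "nat \<Rightarrow> ell2" is "\<lambda>j n. if n = j then 1 else 0"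
  subgoal for j
    by (rule summable_finite[of "{j}"]) auto
  done

lift_definition cmul :: "complex \<Rightarrow> ell2 \<Rightarrow> ell2" is "\<lambda>c x n. c * x n"
  by (simp add: norm_mult power_mult_distrib summable_mult)

lemma norm_cmul: "norm (cmul c x) = cmod c * norm x"
proof (rule power2_eq_imp_eq)
  show "(norm (cmul c x))\<^sup>2 = (cmod c * norm x)\<^sup>2"
    by (simp add: norm_ell2_power2 power_mult_distrib cmul.rep_eq norm_mult
        suminf_mult[OF ell2_summable])
qed auto

lemma bounded_bilinear_cmul: "bounded_bilinear cmul"
proof
  show "\<exists>K. \<forall>a b. norm (cmul a b) \<le> norm a * norm b * K"
    by (intro exI[of _ 1]) (simp add: norm_cmul)
qed (transfer; auto simp: fun_eq_iff algebra_simps)+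

lemma norm_basis_ell2: "norm (basis_ell2 j) = 1"
proof -
  have "(\<lambda>n. if n = j then 1 else 0::real) sums 1"
    using sums_single[of j "\<lambda>_. 1::real"] by simp
  moreover have "(\<lambda>n. (cmod (ell2_nth (basis_ell2 j) n))\<^sup>2) = (\<lambda>n. if n = j then 1 else 0)"
    by (auto simp: basis_ell2.rep_eq)
  ultimately show ?thesis
    by (simp add: norm_ell2_def sums_unique[symmetric])
qed

lemma basis_expansion: "(\<lambda>j. cmul (ell2_nth x j) (basis_ell2 j)) sums x"
proof -
  define s where "s N = (\<Sum>j<N. cmul (ell2_nth x j) (basis_ell2 j))" for N
  have s_nth: "ell2_nth (s N) n = (if n < N then ell2_nth x n else 0)" for N n
    unfolding s_def
    by (induction N) (auto simp: zero_ell2.rep_eq plus_ell2.rep_eq cmul.rep_eq basis_ell2.rep_eq less_Suc_eq)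
  have err: "(norm (s N - x))\<^sup>2 = (norm x)\<^sup>2 - (\<Sum>n<N. (cmod (ell2_nth x n))\<^sup>2)" for N
  proof -
    have "(\<lambda>n. (cmod (ell2_nth x n))\<^sup>2 - (if n \<in> {..<N} then (cmod (ell2_nth x n))\<^sup>2 else 0))
        sums ((norm x)\<^sup>2 - (\<Sum>n<N. (cmod (ell2_nth x n))\<^sup>2))"
      unfolding norm_ell2_power2
      by (intro sums_diff summable_sums ell2_summable sums_If_finite_set) simp
    moreover have "(\<lambda>n. (cmod (ell2_nth x n))\<^sup>2 - (if n \<in> {..<N} then (cmod (ell2_nth x n))\<^sup>2 else 0))
        = (\<lambda>n. (cmod (ell2_nth (s N - x) n))\<^sup>2)"
      by (auto simp: fun_eq_iff minus_ell2.rep_eq s_nth)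
    ultimately show ?thesis
      using norm_ell2_power2[of "s N - x"] sums_unique by metis
  qed
  have "(\<lambda>N. (norm x)\<^sup>2 - (\<Sum>n<N. (cmod (ell2_nth x n))\<^sup>2)) \<longlonglongrightarrow> (norm x)\<^sup>2 - (norm x)\<^sup>2"
    unfolding norm_ell2_power2 by (intro tendsto_intros summable_LIMSEQ ell2_summable)
  then have "(\<lambda>N. (norm (s N - x))\<^sup>2) \<longlonglongrightarrow> 0" by (simp add: err)
  from tendsto_real_sqrt[OF this] have "(\<lambda>N. norm (s N - x)) \<longlonglongrightarrow> 0" by simp
  then have "(\<lambda>N. s N - x) \<longlonglongrightarrow> 0" by (simp add: tendsto_norm_zero_iff)
  then show ?thesis unfolding sums_def s_def[symmetric] by (simp add: LIM_zero_iff)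
qed

definition complex_linear :: "(ell2 \<Rightarrow>\<^sub>L ell2) \<Rightarrow> bool"
  where "complex_linear T \<longleftrightarrow> (\<forall>c x. T (cmul c x) = cmul c (T x))"

definition matrix_of :: "(ell2 \<Rightarrow>\<^sub>L ell2) \<Rightarrow> inf_mat"
  where "matrix_of T = (\<lambda>i j. ell2_nth (T (basis_ell2 j)) i)"

text \<open>This is where continuity enters: \<open>T x\<close> is the limit of the images of the truncations of
\<open>x\<close>, hence its coordinates are the sums that define the matrix-vector product.\<close>
lemma matrix_of_sums:
  assumes "complex_linear T"
  shows "(\<lambda>j. matrix_of T i j * ell2_nth x j) sums ell2_nth (T x) i"
proof -
  have "bounded_linear (\<lambda>x. ell2_nth (T x) i)"
    by (rule bounded_linear_compose[OF bounded_linear_ell2_nth blinfun.bounded_linear_right])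
  from bounded_linear.sums[OF this basis_expansion[of x]] assms
  show ?thesis
    by (simp add: complex_linear_def matrix_of_def cmul.rep_eq mult.commute)
qed

lemma matrix_of_inject:
  assumes "complex_linear S" "complex_linear T" "matrix_of S = matrix_of T"
  shows "S = T"
proof (intro blinfun_eqI ell2_eqI)
  fix x i
  show "ell2_nth (S x) i = ell2_nth (T x) i"
    using matrix_of_sums[OF assms(1), of i x] matrix_of_sums[OF assms(2), of i x] assms(3)
    by (simp add: sums_unique2)
qed

lemma mat_op_matrix_of:
  assumes "complex_linear T"
  shows "mat_op (matrix_of T) = blinfun_apply T"
proof
  fix x
  have "(\<lambda>i. \<Sum>j. matrix_of T i j * ell2_nth x j) = ell2_nth (T x)"
    using sums_unique[OF matrix_of_sums[OF assms]] by (simp add: fun_eq_iff)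
  then show "mat_op (matrix_of T) x = T x"
    by (simp add: mat_op_def ell2_nth_inverse)
qed

lemma bounded_mat_matrix_of:
  assumes "complex_linear T"
  shows "bounded_mat (matrix_of T)"
proof -
  have "(\<Sum>j. matrix_of T i j * ell2_nth x j) = ell2_nth (T x) i" for i x
    using sums_unique[OF matrix_of_sums[OF assms]] by simp
  then show ?thesis
    unfolding bounded_mat_def mat_op_matrix_of[OF assms]
    by (simp add: sums_summable[OF matrix_of_sums[OF assms]] ell2_summable
        blinfun.bounded_linear_right)
qed

lemma bounded_matE:
  assumes "bounded_mat A"
  obtains T where "complex_linear T" "A = matrix_of T"
proof
  define T where "T = Blinfun (mat_op A)"
  have T: "blinfun_apply T = mat_op A"
    unfolding T_def using assms by (intro bounded_linear_Blinfun_apply) (simp add: bounded_mat_def)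
  have nth: "ell2_nth (mat_op A x) i = (\<Sum>j. A i j * ell2_nth x j)" for x i
    using assms unfolding mat_op_def bounded_mat_def by (subst ell2_nth_Abs) auto
  have summ: "summable (\<lambda>j. A i j * ell2_nth x j)" for x i
    using assms by (simp add: bounded_mat_def)
  show "complex_linear T"
    unfolding complex_linear_def
  proof (intro allI ell2_eqI)
    fix c x i
    show "ell2_nth (T (cmul c x)) i = ell2_nth (cmul c (T x)) i"
      by (simp add: T nth cmul.rep_eq mult.left_commute suminf_mult[OF summ])
  qed
  have "(\<Sum>k. A i k * ell2_nth (basis_ell2 j) k) = A i j" for i j
    by (subst suminf_finite[of "{j}"]) (auto simp: basis_ell2.rep_eq)
  then show "A = matrix_of T"
    by (simp add: fun_eq_iff matrix_of_def T nth)
qed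

lemma matrix_of_compose:
  assumes "complex_linear S"
  shows "(\<lambda>k. matrix_of S i k * matrix_of T k j) sums matrix_of (S o\<^sub>L T) i j"
  using matrix_of_sums[OF assms, of i "T (basis_ell2 j)"] by (simp add: matrix_of_def)

lemma mat_mult_matrix_of:
  "complex_linear S \<Longrightarrow> mat_mult (matrix_of S) (matrix_of T) = matrix_of (S o\<^sub>L T)"
  unfolding mat_mult_def by (simp add: fun_eq_iff sums_unique[OF matrix_of_compose])

text \<open>Complex multiples of an operator are compositions with a multiplication operator, because
the type of bounded operators is only a real vector space.\<close>
definition cmulL :: "complex \<Rightarrow> ell2 \<Rightarrow>\<^sub>L ell2"
  where "cmulL c = Blinfun (cmul c)"

lemma cmulL_apply [simp]: "cmulL c x = cmul c x"
  by (simp add: cmulL_def bounded_linear_Blinfun_apply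
      bounded_bilinear.bounded_linear_right[OF bounded_bilinear_cmul])

lemma complex_linear_add: "complex_linear S \<Longrightarrow> complex_linear T \<Longrightarrow> complex_linear (S + T)"
  by (simp add: complex_linear_def blinfun.bilinear_simps
      bounded_bilinear.add_right[OF bounded_bilinear_cmul])

lemma complex_linear_diff: "complex_linear S \<Longrightarrow> complex_linear T \<Longrightarrow> complex_linear (S - T)"
  by (simp add: complex_linear_def blinfun.bilinear_simps
      bounded_bilinear.diff_right[OF bounded_bilinear_cmul])

lemma complex_linear_compose: "complex_linear S \<Longrightarrow> complex_linear T \<Longrightarrow> complex_linear (S o\<^sub>L T)"
  by (simp add: complex_linear_def)

lemma complex_linear_0: "complex_linear 0"
  by (simp add: complex_linear_def bounded_bilinear.zero_right[OF bounded_bilinear_cmul])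

lemma complex_linear_id: "complex_linear id_blinfun"
  by (simp add: complex_linear_def)

lemma complex_linear_cmulL: "complex_linear (cmulL c)"
  unfolding complex_linear_def cmulL_apply
  by (intro allI ell2_eqI) (simp add: cmul.rep_eq)

lemma closed_complex_linear: "closed {T. complex_linear T}"
  unfolding complex_linear_def
  by (intro closed_Collect_all closed_Collect_eq linear_continuous_on
      bounded_linear_compose[OF bounded_bilinear.bounded_linear_right[OF bounded_bilinear_cmul]]
      blinfun.bounded_linear_left)

lemma matrix_of_add: "matrix_of (S + T) = matrix_of S + matrix_of T"
  and matrix_of_diff: "matrix_of (S - T) = matrix_of S - matrix_of T"
  and matrix_of_0: "matrix_of 0 = 0"
  and matrix_of_id: "matrix_of id_blinfun = mat_one"
  and matrix_of_cmulL: "matrix_of (cmulL c o\<^sub>L T) = mat_scale c (matrix_of T)"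
  by (auto simp: fun_eq_iff matrix_of_def blinfun.bilinear_simps plus_ell2.rep_eq minus_ell2.rep_eq
      zero_ell2.rep_eq mat_one_def basis_ell2.rep_eq mat_scale_def cmul.rep_eq)

lemma norm_cmulL_compose:
  fixes T :: "'a::real_normed_vector \<Rightarrow>\<^sub>L ell2"
  shows "norm (cmulL c o\<^sub>L T) = cmod c * norm T"
proof -
  have le: "norm (cmulL c o\<^sub>L T) \<le> cmod c * norm T" for c and T :: "'a \<Rightarrow>\<^sub>L ell2"
    by (rule norm_blinfun_bound)
      (auto simp: norm_cmul mult.assoc intro!: mult_left_mono norm_blinfun)
  show ?thesis
  proof (cases "c = 0")
    case False
    have "cmulL (inverse c) o\<^sub>L (cmulL c o\<^sub>L T) = T"
      using False by (intro blinfun_eqI ell2_eqI) (simp add: cmul.rep_eq)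
    with le[of "inverse c" "cmulL c o\<^sub>L T"] have "norm T \<le> norm (cmulL c o\<^sub>L T) / cmod c"
      by (simp add: norm_inverse divide_inverse_commute)
    with False le[of c T] show ?thesis by (simp add: field_simps)
  qed (use le[of 0 T] in simp)
qed


section \<open>Compact operators\<close>

definition compact_op :: "(ell2 \<Rightarrow>\<^sub>L ell2) \<Rightarrow> bool"
  where "compact_op T \<longleftrightarrow> compact (closure (blinfun_apply T ` ball 0 1))"

lemma compact_op_iff: "compact_op T \<longleftrightarrow> (\<exists>C. compact C \<and> blinfun_apply T ` ball 0 1 \<subseteq> C)"
proof
  assume "compact_op T"
  then show "\<exists>C. compact C \<and> blinfun_apply T ` ball 0 1 \<subseteq> C"
    unfolding compact_op_def by (intro exI[of _ "closure (blinfun_apply T ` ball 0 1)"] conjI closure_subset) assumption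
next
  assume "\<exists>C. compact C \<and> blinfun_apply T ` ball 0 1 \<subseteq> C"
  then obtain C where C: "compact C" "blinfun_apply T ` ball 0 1 \<subseteq> C" by (elim exE conjE)
  then have "closure (blinfun_apply T ` ball 0 1) = C \<inter> closure (blinfun_apply T ` ball 0 1)"
    by (intro Int_absorb1[symmetric] closure_minimal compact_imp_closed)
  also have "compact \<dots>" by (intro compact_Int_closed C(1)) simp
  finally show "compact_op T" unfolding compact_op_def .
qed

lemma compact_op_add:
  assumes "compact_op S" "compact_op T"
  shows "compact_op (S + T)"
proof -
  from assms obtain C D where "compact C" "S ` ball 0 1 \<subseteq> C" "compact D" "T ` ball 0 1 \<subseteq> D"
    by (auto simp: compact_op_iff)
  then show ?thesis
    unfolding compact_op_iff
    by (intro exI[of _ "\<Union>x\<in>C. \<Union>y\<in>D. {x + y}"] conjI compact_sums')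
      (auto simp: blinfun.bilinear_simps image_subset_iff)
qed

lemma compact_op_compose_left:
  assumes "compact_op T"
  shows "compact_op (L o\<^sub>L T)"
proof -
  from assms obtain C where "compact C" "T ` ball 0 1 \<subseteq> C"
    by (auto simp: compact_op_iff)
  then show ?thesis
    unfolding compact_op_iff
    by (intro exI[of _ "L ` C"])
      (auto intro!: compact_continuous_image continuous_intros)
qed

text \<open>The image of the unit ball under \<open>R\<close> need not lie in the unit ball, but lies in a multiple
of it, so the compact set is scaled accordingly.\<close>
lemma compact_op_compose_right:
  assumes "compact_op T"
  shows "compact_op (T o\<^sub>L R)"
proof -
  from assms obtain C where C: "compact C" "T ` ball 0 1 \<subseteq> C"
    by (auto simp: compact_op_iff)
  define r where "r = norm R + 1"
  have r: "0 < r" by (simp add: r_def add_nonneg_pos)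
  have "T (R x) \<in> (*\<^sub>R) r ` C" if x: "norm x < 1" for x
  proof -
    have "norm (R x) \<le> norm R * norm x" by (rule norm_blinfun)
    also have "\<dots> \<le> norm R" using x by (simp add: mult_left_le)
    also have "\<dots> < r" by (simp add: r_def)
    finally have "R x /\<^sub>R r \<in> ball 0 1" using r by (simp add: field_simps)
    with C(2) have "T (R x /\<^sub>R r) \<in> C" by blast
    moreover have "T (R x) = r *\<^sub>R T (R x /\<^sub>R r)" using r by (simp add: blinfun.bilinear_simps)
    ultimately show ?thesis by blast
  qed
  then show ?thesis
    unfolding compact_op_iff using compact_scaling[OF C(1), of r]
    by (intro exI[of _ "(*\<^sub>R) r ` C"]) auto
qed

text \<open>The classical argument with total boundedness: a finite net for an operator close to \<open>T\<close>
on the unit ball is also a, slightly coarser, net for \<open>T\<close>. Completeness of the sequence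
space turns total boundedness into compactness.\<close>
lemma closed_compact_op: "closed {T. compact_op T}"
proof -
  have "compact_op T" if T: "\<forall>e>0. \<exists>S\<in>{T. compact_op T}. dist S T < e" for T
  proof -
    have "\<exists>k. finite k \<and> closure (blinfun_apply T ` ball 0 1) \<subseteq> (\<Union>x\<in>k. ball x e)" if "0 < e" for e
    proof -
      have e4: "0 < e/4" using that by simp
      with T obtain S where S: "compact_op S" "dist S T < e/4" by blast
      from S(1) obtain C where C: "compact C" "S ` ball 0 1 \<subseteq> C" by (auto simp: compact_op_iff)
      from C(1) e4 obtain k where k: "finite k" "C \<subseteq> (\<Union>x\<in>k. ball x (e/4))"
        unfolding compact_eq_totally_bounded by blast
      have "blinfun_apply T ` ball 0 1 \<subseteq> (\<Union>x\<in>k. cball x (e/2))"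
      proof safe
        fix x :: ell2
        assume x: "x \<in> ball 0 1"
        then have "S x \<in> (\<Union>x\<in>k. ball x (e/4))" using C(2) k(2) by blast
        then obtain z where z: "z \<in> k" "dist z (S x) < e/4" by auto
        have "dist (S x) (T x) \<le> norm (S - T) * norm x"
          using norm_blinfun[of "S - T" x] by (simp add: dist_norm blinfun.bilinear_simps)
        also have "\<dots> \<le> norm (S - T)" using x by (simp add: mult_left_le)
        also have "\<dots> < e/4" using S(2) by (simp add: dist_norm)
        finally have "dist z (T x) \<le> e/2"
          using z(2) dist_triangle[of z "T x" "S x"] by linarith
        with z(1) show "T x \<in> (\<Union>x\<in>k. cball x (e/2))" by auto
      qed
      then have "closure (blinfun_apply T ` ball 0 1) \<subseteq> (\<Union>x\<in>k. cball x (e/2))"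
        using k(1) by (intro closure_minimal closed_UN) auto
      also have "\<dots> \<subseteq> (\<Union>x\<in>k. ball x e)" using that by (intro UN_mono) auto
      finally show ?thesis using k(1) by blast
    qed
    then show ?thesis
      unfolding compact_op_def compact_eq_totally_bounded by (simp add: complete_eq_closed)
  qed
  then show ?thesis
    unfolding closure_subset_eq[symmetric] by (auto simp: closure_approachable)
qed

text \<open>The space in which the correction \<open>E\<close> of a quasi-Toeplitz matrix lives: a closed subspace
and an ideal with respect to the complex-linear operators.\<close>
definition compact_linear_ops :: "(ell2 \<Rightarrow>\<^sub>L ell2) set"
  where "compact_linear_ops = {K. complex_linear K \<and> compact_op K}"

lemma compact_mat_iff: "compact_mat E \<longleftrightarrow> (\<exists>K\<in>compact_linear_ops. E = matrix_of K)"
  unfolding compact_mat_def compact_linear_ops_def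
  by (auto simp: mat_op_matrix_of bounded_mat_matrix_of compact_op_def elim!: bounded_matE)

lemma closed_compact_linear_ops: "closed compact_linear_ops"
  unfolding compact_linear_ops_def Collect_conj_eq
  by (intro closed_Int closed_complex_linear closed_compact_op)

lemma compact_linear_ops_0: "0 \<in> compact_linear_ops"
  by (auto simp: compact_linear_ops_def complex_linear_0 compact_op_def image_constant_conv)

lemma compact_linear_ops_add:
  "K \<in> compact_linear_ops \<Longrightarrow> L \<in> compact_linear_ops \<Longrightarrow> K + L \<in> compact_linear_ops"
  by (simp add: compact_linear_ops_def complex_linear_add compact_op_add)

lemma compact_linear_ops_compose_left:
  "complex_linear T \<Longrightarrow> K \<in> compact_linear_ops \<Longrightarrow> T o\<^sub>L K \<in> compact_linear_ops"
  by (simp add: compact_linear_ops_def complex_linear_compose compact_op_compose_left)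

lemma compact_linear_ops_compose_right:
  "complex_linear T \<Longrightarrow> K \<in> compact_linear_ops \<Longrightarrow> K o\<^sub>L T \<in> compact_linear_ops"
  by (simp add: compact_linear_ops_def complex_linear_compose compact_op_compose_right)

lemma cmulL_minus_one: "cmulL (- 1) o\<^sub>L T = - T"
  by (intro blinfun_eqI ell2_eqI) (simp add: cmul.rep_eq blinfun.bilinear_simps uminus_ell2.rep_eq)

lemma compact_linear_ops_diff:
  assumes "K \<in> compact_linear_ops" "L \<in> compact_linear_ops"
  shows "K - L \<in> compact_linear_ops"
  using compact_linear_ops_add[OF assms(1)
      compact_linear_ops_compose_left[OF complex_linear_cmulL[of "-1"] assms(2)]]
  by (simp add: cmulL_minus_one)


section \<open>Toeplitz operators, Hankel operators and their products\<close>

lemma infsum_in_closed: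
  fixes f :: "'i \<Rightarrow> 'b::{topological_comm_monoid_add, t2_space}"
  assumes "f summable_on A" "closed V" "0 \<in> V" "\<And>x y. x \<in> V \<Longrightarrow> y \<in> V \<Longrightarrow> x + y \<in> V"
    and "\<And>i. i \<in> A \<Longrightarrow> f i \<in> V"
  shows "infsum f A \<in> V"
proof (rule Lim_in_closed_set[OF \<open>closed V\<close>])
  have "sum f F \<in> V" if "finite F" "F \<subseteq> A" for F
    using that by (induction F rule: finite_induct) (auto intro: assms(3-5))
  then show "\<forall>\<^sub>F F in finite_subsets_at_top A. sum f F \<in> V"
    by (intro eventually_finite_subsets_at_top_weakI)
  show "(sum f \<longlongrightarrow> infsum f A) (finite_subsets_at_top A)"
    using has_sum_infsum[OF assms(1)] by (simp add: has_sum_def)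
qed simp

abbreviation ell1 :: "(int \<Rightarrow> complex) \<Rightarrow> bool"
  where "ell1 c \<equiv> (\<lambda>k. cmod (c k)) summable_on UNIV"

text \<open>Toeplitz and Hankel matrices are both combinations \<open>\<Sum>k. c k P k\<close> of contractions: all
entries of the matrix that carry the coefficient \<open>c k\<close> form a 0-1 matrix \<open>P k\<close> with at most
one entry per row and per column. For absolutely summable \<open>c\<close> such a series converges in
operator norm, which gives at once the norm bound by the Wiener norm, complex linearity,
and compactness of the sum when every \<open>P k\<close> is compact.\<close>
definition op_series :: "(int \<Rightarrow> complex) \<Rightarrow> (int \<Rightarrow> ell2 \<Rightarrow>\<^sub>L ell2) \<Rightarrow> ell2 \<Rightarrow>\<^sub>L ell2"
  where "op_series c P = (\<Sum>\<^sub>\<infinity>k. cmulL (c k) o\<^sub>L P k)"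

context
  fixes c :: "int \<Rightarrow> complex" and P :: "int \<Rightarrow> ell2 \<Rightarrow>\<^sub>L ell2"
  assumes c: "ell1 c" and P: "\<And>k. norm (P k) \<le> 1"
begin

lemma op_series_term_le: "norm (cmulL (c k) o\<^sub>L P k) \<le> cmod (c k)"
  using mult_left_mono[OF P, of "cmod (c k)"] by (simp add: norm_cmulL_compose)

lemma op_series_abs_summable: "(\<lambda>k. norm (cmulL (c k) o\<^sub>L P k)) summable_on UNIV"
  by (rule Infinite_Sum.abs_summable_on_comparison_test'[OF c]) (simp add: op_series_term_le)

lemma op_series_summable: "(\<lambda>k. cmulL (c k) o\<^sub>L P k) summable_on UNIV"
  by (rule abs_summable_summable[OF op_series_abs_summable])

lemma norm_op_series: "norm (op_series c P) \<le> (\<Sum>\<^sub>\<infinity>k. cmod (c k))"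
  unfolding op_series_def
  by (rule order_trans[OF norm_infsum_bound[OF op_series_abs_summable]
        infsum_mono[OF op_series_abs_summable c op_series_term_le]])

lemma matrix_of_op_series: "matrix_of (op_series c P) i j = (\<Sum>\<^sub>\<infinity>k. c k * matrix_of (P k) i j)"
proof -
  have "bounded_linear (\<lambda>T. ell2_nth (blinfun_apply T (basis_ell2 j)) i)"
    by (rule bounded_linear_compose[OF bounded_linear_ell2_nth blinfun.bounded_linear_left])
  from has_sum_bounded_linear[OF this has_sum_infsum[OF op_series_summable]]
  show ?thesis
    by (simp add: op_series_def matrix_of_def cmul.rep_eq infsumI)
qed

lemma complex_linear_op_series:
  assumes "\<And>k. complex_linear (P k)"
  shows "complex_linear (op_series c P)"
  using infsum_in_closed[OF op_series_summable closed_complex_linear]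
  by (simp add: op_series_def assms complex_linear_0 complex_linear_add complex_linear_compose
      complex_linear_cmulL)

lemma compact_linear_op_series:
  assumes "\<And>k. P k \<in> compact_linear_ops"
  shows "op_series c P \<in> compact_linear_ops"
  unfolding op_series_def
  by (intro infsum_in_closed[OF op_series_summable closed_compact_linear_ops] assms
      compact_linear_ops_0 compact_linear_ops_add compact_linear_ops_compose_left
      complex_linear_cmulL)

end

text \<open>The operator of a 0-1 matrix with exactly one entry 1, in column \<open>g n\<close>, in each row \<open>n\<close>
of \<open>D\<close>, the other rows being zero. It is a contraction when no column is hit twice.\<close>
definition reindex :: "nat set \<Rightarrow> (nat \<Rightarrow> nat) \<Rightarrow> ell2 \<Rightarrow> ell2"
  where "reindex D g x = Abs_ell2 (\<lambda>n. if n \<in> D then ell2_nth x (g n) else 0)"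

definition reindexL :: "nat set \<Rightarrow> (nat \<Rightarrow> nat) \<Rightarrow> ell2 \<Rightarrow>\<^sub>L ell2"
  where "reindexL D g = Blinfun (reindex D g)"

context
  fixes D :: "nat set" and g :: "nat \<Rightarrow> nat"
  assumes inj: "inj_on g D"
begin

lemma reindex_partial_sum_le:
  "(\<Sum>n<N. (cmod (if n \<in> D then ell2_nth x (g n) else 0))\<^sup>2) \<le> (norm x)\<^sup>2"
proof -
  have "(\<Sum>n<N. (cmod (if n \<in> D then ell2_nth x (g n) else 0))\<^sup>2)
      = (\<Sum>n\<in>{..<N} \<inter> D. (cmod (ell2_nth x (g n)))\<^sup>2)"
    by (subst sum.inter_restrict) (auto intro!: sum.cong)
  also have "\<dots> = (\<Sum>m\<in>g ` ({..<N} \<inter> D). (cmod (ell2_nth x m))\<^sup>2)"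
    by (subst sum.reindex) (auto intro: inj_on_subset[OF inj])
  also have "\<dots> \<le> (norm x)\<^sup>2"
    unfolding norm_ell2_power2 by (intro sum_le_suminf ell2_summable) auto
  finally show ?thesis .
qed

lemma ell2_nth_reindex: "ell2_nth (reindex D g x) n = (if n \<in> D then ell2_nth x (g n) else 0)"
  unfolding reindex_def
  using ell2_nth_Abs[OF square_summable_bounded_sums[OF reindex_partial_sum_le[of x]]] by simp

lemma norm_reindex_le: "norm (reindex D g x) \<le> norm x"
  by (subst norm_ell2_le_iff) (use reindex_partial_sum_le in \<open>auto simp: ell2_nth_reindex\<close>)

lemma reindexL_apply: "reindexL D g x = reindex D g x"
proof -
  have "bounded_linear (reindex D g)"
    by (rule bounded_linear_intro[of _ 1])
      (auto intro!: ell2_eqI simp: ell2_nth_reindex plus_ell2.rep_eq scaleR_ell2.rep_eq norm_reindex_le)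
  then show ?thesis by (simp add: reindexL_def bounded_linear_Blinfun_apply)
qed

lemma norm_reindexL_le: "norm (reindexL D g) \<le> 1"
  by (rule norm_blinfun_bound) (simp_all add: reindexL_apply norm_reindex_le)

lemma complex_linear_reindexL: "complex_linear (reindexL D g)"
  by (auto simp: complex_linear_def reindexL_apply ell2_nth_reindex cmul.rep_eq intro!: ell2_eqI)

lemma matrix_of_reindexL: "matrix_of (reindexL D g) i j = (if i \<in> D \<and> g i = j then 1 else 0)"
  by (auto simp: matrix_of_def reindexL_apply ell2_nth_reindex basis_ell2.rep_eq)

end

lemma compact_op_coordinate: "compact_op (reindexL {N} (\<lambda>n. n))"
  unfolding compact_op_iff
proof (intro exI conjI)
  show "compact ((\<lambda>z. cmul z (basis_ell2 N)) ` cball 0 1)"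
    by (intro compact_continuous_image compact_cball linear_continuous_on
        bounded_bilinear.bounded_linear_left[OF bounded_bilinear_cmul])
  show "reindexL {N} (\<lambda>n. n) ` ball 0 1 \<subseteq> (\<lambda>z. cmul z (basis_ell2 N)) ` cball 0 1"
  proof safe
    fix x :: ell2
    assume "x \<in> ball 0 1"
    then have "ell2_nth x N \<in> cball 0 1"
      using cmod_ell2_nth_le_norm[of x N] by simp
    moreover have "reindexL {N} (\<lambda>n. n) x = cmul (ell2_nth x N) (basis_ell2 N)"
      by (rule ell2_eqI) (simp add: reindexL_apply ell2_nth_reindex cmul.rep_eq basis_ell2.rep_eq)
    ultimately show "reindexL {N} (\<lambda>n. n) x \<in> (\<lambda>z. cmul z (basis_ell2 N)) ` cball 0 1" by blast
  qed
qed

lemma compact_op_truncation: "compact_op (reindexL {..<N} (\<lambda>n. n))"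
proof (induction N)
  case 0
  have "reindexL {..<0} (\<lambda>n. n) = 0"
    by (intro blinfun_eqI ell2_eqI) (simp add: reindexL_apply ell2_nth_reindex zero_ell2.rep_eq)
  then show ?case
    using compact_linear_ops_0 by (simp add: compact_linear_ops_def)
next
  case (Suc N)
  have "reindexL {..<Suc N} (\<lambda>n. n) = reindexL {..<N} (\<lambda>n. n) + reindexL {N} (\<lambda>n. n)"
    by (intro blinfun_eqI ell2_eqI)
      (auto simp: reindexL_apply ell2_nth_reindex plus_ell2.rep_eq blinfun.bilinear_simps)
  with Suc compact_op_coordinate show ?case by (simp add: compact_op_add)
qed

text \<open>An operator with finitely many nonzero rows is unchanged by truncating its values, and
truncation is a finite sum of coordinate projections, which are compact.\<close>
lemma compact_op_finite_rows:
  fixes T :: "ell2 \<Rightarrow>\<^sub>L ell2"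
  assumes "\<And>x n. N \<le> n \<Longrightarrow> ell2_nth (T x) n = 0"
  shows "compact_op T"
proof -
  have "reindexL {..<N} (\<lambda>n. n) o\<^sub>L T = T"
    by (intro blinfun_eqI ell2_eqI) (simp add: reindexL_apply ell2_nth_reindex assms)
  with compact_op_compose_right[OF compact_op_truncation, of N T] show ?thesis by simp
qed

text \<open>The 0-1 matrices of the \<open>k\<close>-th diagonal, where \<open>j - i = k\<close>, and of the \<open>k\<close>-th antidiagonal.
Since indices start at 0, the Hankel matrix with entries \<open>c (i + j + 1)\<close> has the
coefficient \<open>c k\<close> on the antidiagonal \<open>i + j = k - 1\<close>; this is empty for \<open>k \<le> 0\<close>, so that
only coefficients with positive index contribute.\<close>
definition shift_op :: "int \<Rightarrow> ell2 \<Rightarrow>\<^sub>L ell2"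
  where "shift_op k = reindexL {n. 0 \<le> int n + k} (\<lambda>n. nat (int n + k))"

definition flip_op :: "int \<Rightarrow> ell2 \<Rightarrow>\<^sub>L ell2"
  where "flip_op k = reindexL {n. int n < k} (\<lambda>n. nat (k - 1 - int n))"

lemma inj_shift: "inj_on (\<lambda>n. nat (int n + k)) {n. 0 \<le> int n + k}"
  by (auto simp: inj_on_def)

lemma inj_flip: "inj_on (\<lambda>n. nat (k - 1 - int n)) {n. int n < k}"
  by (auto simp: inj_on_def)

lemma norm_shift_op: "norm (shift_op k) \<le> 1"
  and complex_linear_shift_op: "complex_linear (shift_op k)"
  and matrix_of_shift_op: "matrix_of (shift_op k) i j = (if k = int j - int i then 1 else 0)"
  unfolding shift_op_def
  by (auto simp: norm_reindexL_le complex_linear_reindexL matrix_of_reindexL inj_shift)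

lemma norm_flip_op: "norm (flip_op k) \<le> 1"
  and complex_linear_flip_op: "complex_linear (flip_op k)"
  and matrix_of_flip_op: "matrix_of (flip_op k) i j = (if k = int i + int j + 1 then 1 else 0)"
  unfolding flip_op_def
  by (auto simp: norm_reindexL_le complex_linear_reindexL matrix_of_reindexL inj_flip)

lemma compact_linear_flip_op: "flip_op k \<in> compact_linear_ops"
proof -
  have "compact_op (flip_op k)"
    by (rule compact_op_finite_rows[of "nat k"])
      (auto simp: flip_op_def reindexL_apply ell2_nth_reindex inj_flip)
  then show ?thesis by (simp add: compact_linear_ops_def complex_linear_flip_op)
qed

definition toeplitz_op :: "(int \<Rightarrow> complex) \<Rightarrow> ell2 \<Rightarrow>\<^sub>L ell2"
  where "toeplitz_op c = op_series c shift_op"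

definition hankel_op :: "(int \<Rightarrow> complex) \<Rightarrow> ell2 \<Rightarrow>\<^sub>L ell2"
  where "hankel_op c = op_series c flip_op"

lemma infsum_single_index: "(\<Sum>\<^sub>\<infinity>k. c k * (if k = m then 1 else 0)) = (c m :: complex)"
proof -
  have "(\<Sum>\<^sub>\<infinity>k. c k * (if k = m then 1 else 0)) = (\<Sum>\<^sub>\<infinity>k\<in>{m}. c k)"
    by (rule infsum_cong_neutral) auto
  then show ?thesis by simp
qed

lemma
  assumes "ell1 c"
  shows norm_toeplitz_op: "norm (toeplitz_op c) \<le> (\<Sum>\<^sub>\<infinity>k. cmod (c k))"
    and complex_linear_toeplitz_op: "complex_linear (toeplitz_op c)"
    and matrix_of_toeplitz_op: "matrix_of (toeplitz_op c) i j = c (int j - int i)"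
  using assms unfolding toeplitz_op_def
  by (simp_all add: norm_op_series complex_linear_op_series matrix_of_op_series norm_shift_op
      complex_linear_shift_op matrix_of_shift_op infsum_single_index)

lemma
  assumes "ell1 c"
  shows norm_hankel_op: "norm (hankel_op c) \<le> (\<Sum>\<^sub>\<infinity>k. cmod (c k))"
    and compact_linear_hankel_op: "hankel_op c \<in> compact_linear_ops"
    and matrix_of_hankel_op: "matrix_of (hankel_op c) i j = c (int i + int j + 1)"
  using assms unfolding hankel_op_def
  by (simp_all add: norm_op_series compact_linear_op_series matrix_of_op_series norm_flip_op
      compact_linear_flip_op matrix_of_flip_op infsum_single_index)

lemma reflected_abs_summable:
  assumes "ell1 c"
  shows "ell1 (\<lambda>k. c (- k))"
proof -
  have "ell1 c \<longleftrightarrow> ?thesis"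
    by (rule summable_on_reindex_bij_witness[where i = uminus and j = uminus]) auto
  with assms show ?thesis by blast
qed

lemma reflected_norm: "(\<Sum>\<^sub>\<infinity>k::int. cmod (c (- k))) = (\<Sum>\<^sub>\<infinity>k. cmod (c k))"
  by (rule infsum_reindex_bij_witness[where i = uminus and j = uminus]) auto

definition convolution :: "(int \<Rightarrow> complex) \<Rightarrow> (int \<Rightarrow> complex) \<Rightarrow> int \<Rightarrow> complex"
  where "convolution c d = (\<lambda>n. \<Sum>\<^sub>\<infinity>k. c k * d (n - k))"

context
  fixes c d :: "int \<Rightarrow> complex"
  assumes c: "ell1 c" and d: "ell1 d"
begin

text \<open>The double family is the tensor product of \<open>c\<close> and \<open>d\<close> in the coordinates
\<open>(n, k) = (k + m, k)\<close>. Everything about convolution follows from its absolute summability.\<close>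
lemma convolution_pairs_abs_summable:
  "(\<lambda>p. cmod (case p of (n, k) \<Rightarrow> c k * d (n - k))) summable_on (UNIV \<times> UNIV)"
proof -
  have "(\<lambda>p. cmod (case p of (k, m) \<Rightarrow> c k * d m)) summable_on (UNIV \<times> UNIV)"
    by (subst Infinite_Sum.abs_summable_on_Sigma_iff)
      (auto simp: norm_mult infsum_cmult_right' infsum_nonneg
        intro!: summable_on_cmult_right summable_on_cmult_left c d)
  also have "?this \<longleftrightarrow> ?thesis"
    by (rule summable_on_reindex_bij_witness[where i = "\<lambda>(n, k). (k, n - k)" and j = "\<lambda>(k, m). (k + m, k)"]) auto
  finally show ?thesis .
qed

lemma convolution_terms_abs_summable: "ell1 (\<lambda>k. c k * d (n - k))"
  using Infinite_Sum.abs_summable_on_Sigma_iff[THEN iffD1, OF convolution_pairs_abs_summable] by auto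

lemma convolution_norms_summable: "(\<lambda>n. \<Sum>\<^sub>\<infinity>k. cmod (c k * d (n - k))) summable_on UNIV"
  using Infinite_Sum.abs_summable_on_Sigma_iff[THEN iffD1, OF convolution_pairs_abs_summable]
  by (auto simp: infsum_nonneg)

lemma cmod_convolution_le: "cmod (convolution c d n) \<le> (\<Sum>\<^sub>\<infinity>k. cmod (c k * d (n - k)))"
  unfolding convolution_def by (rule norm_infsum_bound[OF convolution_terms_abs_summable])

lemma convolution_abs_summable: "ell1 (convolution c d)"
  using convolution_norms_summable cmod_convolution_le by (rule Infinite_Sum.abs_summable_on_comparison_test')

lemma convolution_norm_le:
  "(\<Sum>\<^sub>\<infinity>n. cmod (convolution c d n)) \<le> (\<Sum>\<^sub>\<infinity>n. cmod (c n)) * (\<Sum>\<^sub>\<infinity>n. cmod (d n))"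
proof -
  have "(\<Sum>\<^sub>\<infinity>n. cmod (convolution c d n)) \<le> (\<Sum>\<^sub>\<infinity>n. \<Sum>\<^sub>\<infinity>k. cmod (c k * d (n - k)))"
    by (rule infsum_mono[OF convolution_abs_summable convolution_norms_summable cmod_convolution_le])
  also have "\<dots> = (\<Sum>\<^sub>\<infinity>k. \<Sum>\<^sub>\<infinity>n. cmod (c k * d (n - k)))"
    using convolution_pairs_abs_summable
    by (intro infsum_swap_banach) (simp add: case_prod_unfold)
  also have "\<dots> = (\<Sum>\<^sub>\<infinity>k. cmod (c k) * (\<Sum>\<^sub>\<infinity>m. cmod (d m)))"
  proof (rule infsum_cong)
    fix k
    have "(\<Sum>\<^sub>\<infinity>n. cmod (d (n - k))) = (\<Sum>\<^sub>\<infinity>m. cmod (d m))"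
      by (rule infsum_reindex_bij_witness[where i = "\<lambda>m. m + k" and j = "\<lambda>n. n - k"]) auto
    then show "(\<Sum>\<^sub>\<infinity>n. cmod (c k * d (n - k))) = cmod (c k) * (\<Sum>\<^sub>\<infinity>m. cmod (d m))"
      by (simp add: norm_mult infsum_cmult_right')
  qed
  also have "\<dots> = (\<Sum>\<^sub>\<infinity>n. cmod (c n)) * (\<Sum>\<^sub>\<infinity>n. cmod (d n))"
    by (rule infsum_cmult_left')
  finally show ?thesis .
qed

text \<open>The central identity, in symbol notation \<open>T(a) T(b) = T(ab) - H(a\<^sup>-) H(b\<^sup>+)\<close>. The entry
\<open>(i, j)\<close> of the product on the left sums \<open>c (k - i) d (j - k)\<close> over \<open>k \<ge> 0\<close>, whereas the
convolution coefficient \<open>j - i\<close> sums the same terms over all integers \<open>k\<close>. The terms with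
\<open>k = -1 - m\<close> for \<open>m \<ge> 0\<close> are \<open>c (-(i + m + 1)) d (m + j + 1)\<close>, the terms of a product of
two Hankel matrices.\<close>
lemma toeplitz_op_compose:
  "toeplitz_op c o\<^sub>L toeplitz_op d
    = toeplitz_op (convolution c d) - (hankel_op (\<lambda>k. c (- k)) o\<^sub>L hankel_op d)"
proof (rule matrix_of_inject)
  let ?H = "hankel_op (\<lambda>k. c (- k))" and ?G = "hankel_op d"
  have H: "complex_linear ?H" and G: "complex_linear ?G"
    using compact_linear_hankel_op[OF reflected_abs_summable[OF c]] compact_linear_hankel_op[OF d]
    by (auto simp: compact_linear_ops_def)
  show "complex_linear (toeplitz_op c o\<^sub>L toeplitz_op d)"
    by (intro complex_linear_compose complex_linear_toeplitz_op c d)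
  show "complex_linear (toeplitz_op (convolution c d) - (?H o\<^sub>L ?G))"
    by (intro complex_linear_diff complex_linear_compose complex_linear_toeplitz_op
        convolution_abs_summable H G)
  show "matrix_of (toeplitz_op c o\<^sub>L toeplitz_op d) = matrix_of (toeplitz_op (convolution c d) - (?H o\<^sub>L ?G))"
  proof (intro ext)
    fix i j :: nat
    define F where "F k = c (k - int i) * d (int j - k)" for k
    have "(\<lambda>k. c k * d (int j - int i - k)) summable_on UNIV"
      by (rule abs_summable_summable[OF convolution_terms_abs_summable])
    also have "?this \<longleftrightarrow> F summable_on UNIV"
      unfolding F_def
      by (rule summable_on_reindex_bij_witness[where i = "\<lambda>k. k - int i" and j = "\<lambda>k. k + int i"])
        (auto simp: algebra_simps)
    finally have F: "F summable_on UNIV" .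
    have "infsum F UNIV = convolution c d (int j - int i)"
      unfolding convolution_def F_def
      by (rule infsum_reindex_bij_witness[where i = "\<lambda>k. k + int i" and j = "\<lambda>k. k - int i"])
        (auto simp: algebra_simps)
    then have total: "infsum F UNIV = matrix_of (toeplitz_op (convolution c d)) i j"
      by (simp add: matrix_of_toeplitz_op[OF convolution_abs_summable])
    have F_on: "F summable_on X" for X
      by (rule summable_on_subset_banach[OF F]) simp
    have bij1: "bij_betw int UNIV {0..}"
      by (rule bij_betwI[where g = nat]) auto
    have bij2: "bij_betw (\<lambda>m. - 1 - int m) UNIV {..<0}"
      by (rule bij_betwI[where g = "\<lambda>k. nat (- 1 - k)"]) auto
    have "((\<lambda>m. F (int m)) has_sum infsum F {0..}) UNIV"
      using has_sum_reindex_bij_betw[OF bij1, of F] F_on by simp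
    then have "(\<lambda>m. F (int m)) sums infsum F {0..}" by (rule has_sum_imp_sums)
    moreover have "(\<lambda>m. F (int m)) sums matrix_of (toeplitz_op c o\<^sub>L toeplitz_op d) i j"
      using matrix_of_compose[OF complex_linear_toeplitz_op[OF c], of i "toeplitz_op d" j]
      by (simp add: F_def matrix_of_toeplitz_op c d)
    ultimately have pos: "infsum F {0..} = matrix_of (toeplitz_op c o\<^sub>L toeplitz_op d) i j"
      by (rule sums_unique2)
    have "((\<lambda>m. F (- 1 - int m)) has_sum infsum F {..<0}) UNIV"
      using has_sum_reindex_bij_betw[OF bij2, of F] F_on by simp
    then have "(\<lambda>m. F (- 1 - int m)) sums infsum F {..<0}" by (rule has_sum_imp_sums)
    moreover have "(\<lambda>m. F (- 1 - int m)) sums matrix_of (?H o\<^sub>L ?G) i j"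
      using matrix_of_compose[OF H, of i ?G j]
      by (simp add: F_def matrix_of_hankel_op[OF reflected_abs_summable[OF c]] matrix_of_hankel_op[OF d] algebra_simps)
    ultimately have neg: "infsum F {..<0} = matrix_of (?H o\<^sub>L ?G) i j"
      by (rule sums_unique2)
    have "infsum F ({0..} \<union> {..<0}) = infsum F {0..} + infsum F {..<0}"
      by (intro infsum_Un_disjoint F_on) auto
    moreover have "{0..} \<union> {..<0} = (UNIV :: int set)" by auto
    ultimately show "matrix_of (toeplitz_op c o\<^sub>L toeplitz_op d) i j
        = matrix_of (toeplitz_op (convolution c d) - (?H o\<^sub>L ?G)) i j"
      by (simp add: pos neg total matrix_of_diff)
  qed
qed

end


section \<open>Uniqueness of the decomposition\<close>

lemma ell2_nth_tendsto_0: "ell2_nth y \<longlonglongrightarrow> 0"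
proof -
  have "(\<lambda>n. sqrt ((cmod (ell2_nth y n))\<^sup>2)) \<longlonglongrightarrow> sqrt 0"
    by (intro tendsto_real_sqrt summable_LIMSEQ_zero ell2_summable)
  then show ?thesis by (simp add: tendsto_norm_zero_iff)
qed

text \<open>A compact operator sends a bounded sequence to one with a convergent subsequence, and the
coordinates of the limit tend to zero, so entries in rows that go to infinity cannot stay
equal to a nonzero constant.\<close>
lemma compact_op_constant_entries:
  assumes K: "compact_op K" and v: "filterlim v at_top sequentially"
    and a: "\<And>n. matrix_of K (v n) (u n) = a"
  shows "a = 0"
proof -
  \<comment> \<open>Halving moves the basis vectors from the unit sphere into the open unit ball.\<close>
  define y where "y n = K (basis_ell2 (u n) /\<^sub>R 2)" for n
  have y_nth: "ell2_nth (y n) (v n) = a /\<^sub>R 2" for n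
    using a[of n] by (simp add: y_def matrix_of_def blinfun.bilinear_simps scaleR_ell2.rep_eq)
  have "y n \<in> K ` ball 0 1" for n
    by (auto simp: y_def norm_basis_ell2)
  moreover from K obtain C where "compact C" and C: "K ` ball 0 1 \<subseteq> C" by (auto simp: compact_op_iff)
  ultimately have "\<forall>n. y n \<in> C" by blast
  with \<open>compact C\<close> obtain l r where r: "strict_mono (r :: nat \<Rightarrow> nat)" and l: "(y \<circ> r) \<longlonglongrightarrow> l"
    unfolding compact_def by blast
  have "(\<lambda>n. norm ((y \<circ> r) n - l)) \<longlonglongrightarrow> 0"
    by (intro tendsto_norm_zero LIM_zero l)
  then have "(\<lambda>n. ell2_nth (y (r n) - l) (v (r n))) \<longlonglongrightarrow> 0"
    by (rule Lim_null_comparison[rotated]) (simp add: cmod_ell2_nth_le_norm)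
  moreover have "(\<lambda>n. ell2_nth l (v (r n))) \<longlonglongrightarrow> 0"
    using filterlim_compose[OF ell2_nth_tendsto_0 filterlim_compose[OF v filterlim_subseq[OF r]]] .
  ultimately have "(\<lambda>n. ell2_nth (y (r n) - l) (v (r n)) + ell2_nth l (v (r n))) \<longlonglongrightarrow> 0 + 0"
    by (rule tendsto_add)
  then have "(\<lambda>n. a /\<^sub>R 2) \<longlonglongrightarrow> 0"
    by (simp add: minus_ell2.rep_eq y_nth)
  then show ?thesis by (simp add: tendsto_const_iff)
qed

text \<open>The difference of the two compact parts is a Toeplitz matrix, so it is constant along each
diagonal and each such constant must vanish.\<close>
lemma toeplitz_plus_compact_unique:
  assumes c: "ell1 c" and d: "ell1 d"
    and K: "K \<in> compact_linear_ops" and L: "L \<in> compact_linear_ops"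
    and eq: "matrix_of (toeplitz_op c + K) = matrix_of (toeplitz_op d + L)"
  shows "c = d" "K = L"
proof -
  show "c = d"
  proof
    fix k
    have entry: "matrix_of (L - K) i j = c (int j - int i) - d (int j - int i)" for i j
      using fun_cong[OF fun_cong[OF eq], of i j]
      by (simp add: matrix_of_add matrix_of_diff matrix_of_toeplitz_op c d algebra_simps)
    have "c k - d k = 0"
    proof (rule compact_op_constant_entries)
      show "compact_op (L - K)"
        using compact_linear_ops_diff[OF L K] by (simp add: compact_linear_ops_def)
      \<comment> \<open>The entries \<open>(n + max 0 (-k), n + max 0 k)\<close> run down the \<open>k\<close>-th diagonal.\<close>
      show "filterlim (\<lambda>n. n + nat (- k)) at_top sequentially"
        by (rule filterlim_at_top_mono[OF filterlim_ident]) auto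
      show "matrix_of (L - K) (n + nat (- k)) (n + nat k) = c k - d k" for n
        by (simp add: entry)
    qed
    then show "c k = d k" by simp
  qed
  with eq have "matrix_of K = matrix_of L" by (simp add: matrix_of_add)
  with K L show "K = L" by (intro matrix_of_inject) (auto simp: compact_linear_ops_def)
qed


section \<open>Fourier coefficients\<close>

lemma sum_roots_of_unity_powi:
  fixes N :: nat and m :: int
  assumes "0 < N"
  shows "(\<Sum>k<N. cis (2 * pi * k / N) powi m) = (if int N dvd m then of_nat N else 0)"
proof -
  define w where "w = cis (2 * pi * m / N)"
  have "cis (2 * pi * k / N) powi m = w ^ k" for k :: nat
    unfolding w_def cis_power_int Complex.DeMoivre by (rule arg_cong[where f = cis]) (simp add: field_simps)
  then have sum_eq: "(\<Sum>k<N. cis (2 * pi * k / N) powi m) = (\<Sum>k<N. w ^ k)" by simp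
  have w_N: "w ^ N = 1"
    using assms cis_multiple_2pi[of "of_int m"] by (simp add: w_def Complex.DeMoivre)
  have "w = 1 \<longleftrightarrow> int N dvd m"
  proof
    assume "w = 1"
    then have "cos (2 * pi * m / N) = 1"
      by (metis Re_complex_of_real cis.simps(1) of_real_1 w_def)
    then obtain n :: int where "2 * pi * m / N = n * 2 * pi" by (auto simp: cos_one_2pi_int)
    then have "real_of_int m = real_of_int (n * int N)" using assms by (simp add: field_simps)
    then have "m = n * int N" by (simp only: of_int_eq_iff)
    then show "int N dvd m" by simp
  next
    assume "int N dvd m"
    then obtain n where "m = int N * n" by (elim dvdE)
    then show "w = 1"
      using assms cis_multiple_2pi[of "of_int n"] by (simp add: w_def mult.assoc)
  qed
  then show ?thesis
    using w_N by (auto simp: sum_eq geometric_sum)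
qed

lemma has_sum_finite_sum:
  fixes f :: "'k \<Rightarrow> 'i \<Rightarrow> 'b::topological_comm_monoid_add"
  assumes "finite K" "\<And>k. k \<in> K \<Longrightarrow> (f k has_sum s k) A"
  shows "((\<lambda>i. \<Sum>k\<in>K. f k i) has_sum (\<Sum>k\<in>K. s k)) A"
  using assms by (induction K rule: finite_induct) (auto intro: has_sum_add)

text \<open>A discrete substitute for integration over the circle: averaging the series times \<open>z\<close> to
the power \<open>-n\<close> over the \<open>N\<close>-th roots of unity keeps precisely the coefficients with index
congruent to \<open>n\<close> modulo \<open>N\<close>. Hence \<open>c n\<close> is minus the sum of the others, whose indices
differ from \<open>n\<close> by at least \<open>N\<close>, and this is a tail of an absolutely convergent series.\<close>
lemma fourier_series_zero_imp_coeff_zero: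
  assumes c: "ell1 c" and zero: "\<And>z. cmod z = 1 \<Longrightarrow> ((\<lambda>i. c i * z powi i) has_sum 0) UNIV"
  shows "c n = 0"
proof -
  have multiples: "((\<lambda>i. if int N dvd i - n then c i else 0) has_sum 0) UNIV" if N: "0 < N" for N
  proof -
    let ?z = "\<lambda>k :: nat. cis (2 * pi * k / N)"
    have "((\<lambda>i. \<Sum>k<N. ?z k powi (- n) * (c i * ?z k powi i)) has_sum (\<Sum>k<N. ?z k powi (- n) * 0)) UNIV"
      by (intro has_sum_finite_sum has_sum_cmult_right zero) simp_all
    moreover have "(\<Sum>k<N. ?z k powi (- n) * (c i * ?z k powi i))
        = of_nat N * (if int N dvd i - n then c i else 0)" for i
    proof -
      have "?z k powi (- n) * (c i * ?z k powi i) = c i * ?z k powi (i - n)" for k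
        by (simp add: power_int_diff power_int_minus field_simps)
      then have "(\<Sum>k<N. ?z k powi (- n) * (c i * ?z k powi i)) = c i * (\<Sum>k<N. ?z k powi (i - n))"
        by (simp only: sum_distrib_left)
      then show ?thesis
        unfolding sum_roots_of_unity_powi[OF N] by simp
    qed
    ultimately show ?thesis
      using N by (simp add: has_sum_cmult_right_iff)
  qed
  have "cmod (c n) < e" if e: "0 < e" for e
  proof -
    have "(sum (\<lambda>i. cmod (c i)) \<longlongrightarrow> (\<Sum>\<^sub>\<infinity>i. cmod (c i))) (finite_subsets_at_top UNIV)"
      using has_sum_infsum[OF c] by (simp add: has_sum_def)
    from tendstoD[OF this e] obtain F where F: "finite F"
      "dist (\<Sum>i\<in>F. cmod (c i)) (\<Sum>\<^sub>\<infinity>i. cmod (c i)) < e"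
      unfolding eventually_finite_subsets_at_top by blast
    have c_on: "(\<lambda>i. cmod (c i)) summable_on X" for X
      by (rule summable_on_subset_banach[OF c]) simp
    have "infsum (\<lambda>i. cmod (c i)) (F \<union> - F) = (\<Sum>i\<in>F. cmod (c i)) + infsum (\<lambda>i. cmod (c i)) (- F)"
      using F(1) by (subst infsum_Un_disjoint) (auto intro: c_on)
    then have tail: "infsum (\<lambda>i. cmod (c i)) (- F) < e"
      using F(2) by (simp add: dist_real_def)
    \<comment> \<open>Large enough that no index in \<open>F\<close> other than \<open>n\<close> is congruent to \<open>n\<close> modulo \<open>N\<close>.\<close>
    define N where "N = Suc (\<Sum>i\<in>F. nat \<bar>i - n\<bar>)"
    define G where "G i = (if int N dvd i - n then c i else 0)" for i
    have far: "G i = 0" if i: "i \<in> F" "i \<noteq> n" for i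
    proof -
      have "nat \<bar>i - n\<bar> < N"
        unfolding N_def using member_le_sum[OF i(1), of "\<lambda>i. nat \<bar>i - n\<bar>"] F(1) by simp
      then have "\<not> int N dvd i - n"
        using i(2) dvd_imp_le_int[of "i - n" "int N"] by auto
      then show ?thesis by (simp add: G_def)
    qed
    have G_le: "cmod (G i) \<le> cmod (c i)" for i by (simp add: G_def)
    have G_abs: "(\<lambda>i. cmod (G i)) summable_on X" for X
      by (rule Infinite_Sum.abs_summable_on_comparison_test'[OF c_on G_le])
    have "infsum G ({n} \<union> - {n}) = G n + infsum G (- {n})"
      by (subst infsum_Un_disjoint) (auto intro: abs_summable_summable[OF G_abs])
    moreover have "infsum G UNIV = 0"
      using multiples[of N] by (simp add: G_def[abs_def] N_def infsumI)
    ultimately have "c n = - infsum G (- {n})" by (simp add: G_def add_eq_0_iff2)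
    then have "cmod (c n) \<le> infsum (\<lambda>i. cmod (G i)) (- {n})"
      using norm_infsum_bound[OF G_abs] by simp
    also have "\<dots> \<le> infsum (\<lambda>i. cmod (c i)) (- F)"
      by (rule infsum_mono_neutral[OF G_abs c_on]) (auto simp: G_le far)
    finally show ?thesis using tail by linarith
  qed
  then have "cmod (c n) \<le> 0" by (meson dense_le_bounded less_irrefl not_le)
  then show ?thesis by simp
qed

lemma ell1_diff: "ell1 c \<Longrightarrow> ell1 d \<Longrightarrow> ell1 (\<lambda>k. c k - d k)"
  by (rule Infinite_Sum.abs_summable_on_comparison_test'[where g = "\<lambda>k. cmod (c k) + cmod (d k)"])
    (auto intro: norm_triangle_ineq4 summable_on_add)

lemma ell1_add: "ell1 c \<Longrightarrow> ell1 d \<Longrightarrow> ell1 (\<lambda>k. c k + d k)"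
  by (rule Infinite_Sum.abs_summable_on_comparison_test'[where g = "\<lambda>k. cmod (c k) + cmod (d k)"])
    (auto intro: norm_triangle_ineq summable_on_add)

lemma ell1_scale: "ell1 c \<Longrightarrow> ell1 (\<lambda>k. z * c k)"
  by (simp add: norm_mult summable_on_cmult_right)

lemma wiener_expansion_unique:
  assumes "wiener_expansion c a" "wiener_expansion d a"
  shows "c = d"
proof
  fix n
  have "ell1 (\<lambda>i. c i - d i)"
    using assms by (intro ell1_diff) (auto simp: wiener_expansion_def)
  then have "c n - d n = 0"
  proof (rule fourier_series_zero_imp_coeff_zero)
    fix z :: complex
    assume "cmod z = 1"
    then have "((\<lambda>i. c i * z powi i + - (d i * z powi i)) has_sum (a z + - a z)) UNIV"
      using assms by (intro has_sum_add has_sum_uminusI) (auto simp: wiener_expansion_def)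
    then show "((\<lambda>i. (c i - d i) * z powi i) has_sum 0) UNIV"
      by (simp add: left_diff_distrib)
  qed
  then show "c n = d n" by simp
qed

lemma wiener_coeff_eq: "wiener_expansion c a \<Longrightarrow> wiener_coeff a = c"
  unfolding wiener_coeff_def using wiener_expansion_unique by blast

lemma ell1_wiener_coeff: "a \<in> wiener_class \<Longrightarrow> ell1 (wiener_coeff a)"
  by (auto simp: wiener_class_def wiener_coeff_eq) (simp add: wiener_expansion_def)

lemma wiener_class_of_ell1:
  assumes "ell1 c"
  obtains a where "a \<in> wiener_class" "wiener_coeff a = c"
proof
  define a where "a = restrict (\<lambda>z. \<Sum>\<^sub>\<infinity>i. c i * z powi i) (sphere 0 1)"
  have "(\<lambda>i. c i * z powi i) summable_on UNIV" if "cmod z = 1" for z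
    by (rule abs_summable_summable) (use assms that in \<open>simp add: norm_mult norm_power_int\<close>)
  then have "wiener_expansion c a"
    using assms by (auto simp: wiener_expansion_def a_def)
  then show "a \<in> wiener_class" "wiener_coeff a = c"
    by (auto simp: wiener_class_def wiener_coeff_eq a_def)
qed


section \<open>Quasi-Toeplitz matrices\<close>

lemma toeplitz_eq_matrix_of:
  "a \<in> wiener_class \<Longrightarrow> toeplitz a = matrix_of (toeplitz_op (wiener_coeff a))"
  by (simp add: toeplitz_def fun_eq_iff matrix_of_toeplitz_op ell1_wiener_coeff)

text \<open>From here on a quasi-Toeplitz matrix is handled through its coordinates: the coefficient
family \<open>c\<close>, ranging over all absolutely summable families, and the compact operator \<open>K\<close>.\<close>
definition qt_op :: "(int \<Rightarrow> complex) \<Rightarrow> (ell2 \<Rightarrow>\<^sub>L ell2) \<Rightarrow> ell2 \<Rightarrow>\<^sub>L ell2"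
  where "qt_op c K = toeplitz_op c + K"

lemma complex_linear_qt_op:
  "ell1 c \<Longrightarrow> K \<in> compact_linear_ops \<Longrightarrow> complex_linear (qt_op c K)"
  by (simp add: qt_op_def complex_linear_add complex_linear_toeplitz_op compact_linear_ops_def)

lemma qt_decomp_iff:
  "qt_decomp A a E \<longleftrightarrow> a \<in> wiener_class \<and>
    (\<exists>K\<in>compact_linear_ops. E = matrix_of K \<and> A = matrix_of (qt_op (wiener_coeff a) K))"
  by (auto simp: qt_decomp_def compact_mat_iff qt_op_def matrix_of_add toeplitz_eq_matrix_of)

lemma QT_I:
  assumes "ell1 c" "K \<in> compact_linear_ops"
  shows "matrix_of (qt_op c K) \<in> QT"
proof -
  obtain a where "a \<in> wiener_class" "wiener_coeff a = c" by (rule wiener_class_of_ell1[OF assms(1)])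
  with assms(2) have "qt_decomp (matrix_of (qt_op c K)) a (matrix_of K)"
    by (auto simp: qt_decomp_iff)
  then show ?thesis by (auto simp: QT_def)
qed

lemma QT_E:
  assumes "A \<in> QT"
  obtains c K where "ell1 c" "K \<in> compact_linear_ops" "A = matrix_of (qt_op c K)"
proof -
  from assms obtain a K where "a \<in> wiener_class" "K \<in> compact_linear_ops"
    "A = matrix_of (qt_op (wiener_coeff a) K)"
    by (auto simp: QT_def qt_decomp_iff)
  then show ?thesis by (intro that[OF ell1_wiener_coeff])
qed

text \<open>By uniqueness of the coordinates, the norm is the one of a weighted direct sum of the
space of absolutely summable families and the space of compact operators.\<close>
lemma qt_norm_matrix_of:
  assumes c: "ell1 c" and K: "K \<in> compact_linear_ops"
  shows "qt_norm \<alpha> (matrix_of (qt_op c K)) = \<alpha> * (\<Sum>\<^sub>\<infinity>k. cmod (c k)) + norm K"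
  unfolding qt_norm_def
proof (rule the_equality)
  have onorm: "onorm (mat_op (matrix_of L)) = norm L" if "L \<in> compact_linear_ops" for L
    using that by (simp add: compact_linear_ops_def mat_op_matrix_of norm_blinfun.rep_eq)
  obtain a where "a \<in> wiener_class" "wiener_coeff a = c" by (rule wiener_class_of_ell1[OF c])
  with K show "\<exists>a E. qt_decomp (matrix_of (qt_op c K)) a E \<and>
      \<alpha> * (\<Sum>\<^sub>\<infinity>k. cmod (c k)) + norm K = \<alpha> * wiener_norm a + onorm (mat_op E)"
    by (intro exI[of _ a] exI[of _ "matrix_of K"])
      (auto simp: qt_decomp_iff wiener_norm_def onorm)
  fix r
  assume "\<exists>a E. qt_decomp (matrix_of (qt_op c K)) a E \<and> r = \<alpha> * wiener_norm a + onorm (mat_op E)"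
  then obtain a L where a: "a \<in> wiener_class" and L: "L \<in> compact_linear_ops"
    and eq: "matrix_of (qt_op c K) = matrix_of (qt_op (wiener_coeff a) L)"
    and r: "r = \<alpha> * wiener_norm a + onorm (mat_op (matrix_of L))"
    unfolding qt_decomp_iff by blast
  from toeplitz_plus_compact_unique[OF c ell1_wiener_coeff[OF a] K L] eq
  have "c = wiener_coeff a" "K = L" by (auto simp: qt_op_def)
  with r L show "r = \<alpha> * (\<Sum>\<^sub>\<infinity>k. cmod (c k)) + norm K"
    by (simp add: onorm wiener_norm_def)
qed

lemma toeplitz_op_add:
  assumes "ell1 c" "ell1 d"
  shows "toeplitz_op (\<lambda>k. c k + d k) = toeplitz_op c + toeplitz_op d"
  using assms ell1_add[OF assms]
  by (intro matrix_of_inject complex_linear_add complex_linear_toeplitz_op)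
    (auto simp: matrix_of_add matrix_of_toeplitz_op fun_eq_iff)

lemma toeplitz_op_scale:
  assumes "ell1 c"
  shows "toeplitz_op (\<lambda>k. z * c k) = cmulL z o\<^sub>L toeplitz_op c"
  using assms ell1_scale[OF assms, of z]
  by (intro matrix_of_inject complex_linear_compose complex_linear_cmulL complex_linear_toeplitz_op)
    (auto simp: matrix_of_cmulL mat_scale_def matrix_of_toeplitz_op fun_eq_iff)

lemma qt_op_add:
  assumes "ell1 c" "ell1 d"
  shows "qt_op c K + qt_op d L = qt_op (\<lambda>k. c k + d k) (K + L)"
  by (simp add: qt_op_def toeplitz_op_add[OF assms])

lemma qt_op_scale:
  assumes "ell1 c"
  shows "cmulL z o\<^sub>L qt_op c K = qt_op (\<lambda>k. z * c k) (cmulL z o\<^sub>L K)"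
  by (simp add: qt_op_def toeplitz_op_scale[OF assms] bounded_bilinear.add_right[OF bounded_bilinear_blinfun_compose])

lemma qt_op_diff:
  assumes "ell1 c" "ell1 d"
  shows "qt_op c K - qt_op d L = qt_op (\<lambda>k. c k - d k) (K - L)"
  using qt_op_add[OF ell1_diff[OF assms] assms(2), of "K - L" L] by (simp add: diff_eq_eq)

lemma qt_op_one: "id_blinfun = qt_op (\<lambda>k. if k = 0 then 1 else 0) 0"
  and ell1_one: "ell1 (\<lambda>k. if k = 0 then 1 else 0)"
proof -
  show one: "ell1 (\<lambda>k. if k = 0 then 1 else 0)"
    by (rule finite_nonzero_values_imp_summable_on, rule finite_subset[of _ "{0}"]) auto
  show "id_blinfun = qt_op (\<lambda>k. if k = 0 then 1 else 0) 0"
    unfolding qt_op_def add_0_right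
    by (intro matrix_of_inject complex_linear_id complex_linear_toeplitz_op one)
      (auto simp: matrix_of_id mat_one_def matrix_of_toeplitz_op one fun_eq_iff)
qed

lemma blinfun_compose_assoc: "(R o\<^sub>L S) o\<^sub>L T = R o\<^sub>L (S o\<^sub>L T)"
  by (rule blinfun_eqI) simp

text \<open>In the product of \<open>T(c) + K\<close> and \<open>T(d) + L\<close> the compact part collects the three products
with a compact factor and the Hankel term of the product of the Toeplitz parts. The Hankel
term costs one extra summand, the product of the two Wiener norms.\<close>
lemma qt_op_compose:
  assumes c: "ell1 c" and d: "ell1 d" and K: "K \<in> compact_linear_ops" and L: "L \<in> compact_linear_ops"
  obtains M where "M \<in> compact_linear_ops"
    "qt_op c K o\<^sub>L qt_op d L = qt_op (convolution c d) M"
    "norm M \<le> (\<Sum>\<^sub>\<infinity>k. cmod (c k)) * (\<Sum>\<^sub>\<infinity>k. cmod (d k)) + (\<Sum>\<^sub>\<infinity>k. cmod (c k)) * norm L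
      + norm K * (\<Sum>\<^sub>\<infinity>k. cmod (d k)) + norm K * norm L"
proof
  let ?H = "hankel_op (\<lambda>k. c (- k))" and ?G = "hankel_op d"
  define M where "M = (toeplitz_op c o\<^sub>L L) + (K o\<^sub>L toeplitz_op d) + (K o\<^sub>L L) - (?H o\<^sub>L ?G)"
  have H: "?H \<in> compact_linear_ops" and G: "?G \<in> compact_linear_ops"
    using compact_linear_hankel_op[OF reflected_abs_summable[OF c]] compact_linear_hankel_op[OF d]
    by simp_all
  then show "M \<in> compact_linear_ops"
    unfolding M_def using K L
    by (intro compact_linear_ops_diff compact_linear_ops_add compact_linear_ops_compose_left
        compact_linear_ops_compose_right complex_linear_toeplitz_op c d)
      (auto simp: compact_linear_ops_def)
  show "qt_op c K o\<^sub>L qt_op d L = qt_op (convolution c d) M"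
    by (simp add: qt_op_def M_def toeplitz_op_compose[OF c d]
        bounded_bilinear.add_right[OF bounded_bilinear_blinfun_compose]
        bounded_bilinear.add_left[OF bounded_bilinear_blinfun_compose])
  have bound: "norm (S o\<^sub>L T) \<le> s * t" if "norm S \<le> s" "norm T \<le> t" for S T :: "ell2 \<Rightarrow>\<^sub>L ell2" and s t
    using that by (intro order_trans[OF norm_blinfun_compose] mult_mono)
      (auto intro: order_trans[OF norm_ge_zero])
  have "norm M \<le> norm (toeplitz_op c o\<^sub>L L) + norm (K o\<^sub>L toeplitz_op d) + norm (K o\<^sub>L L) + norm (?H o\<^sub>L ?G)"
    unfolding M_def
    by (intro order_trans[OF norm_triangle_ineq4] add_right_mono order_trans[OF norm_triangle_ineq]) simp
  moreover have "norm (toeplitz_op c o\<^sub>L L) \<le> (\<Sum>\<^sub>\<infinity>k. cmod (c k)) * norm L"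
    by (intro bound norm_toeplitz_op c order_refl)
  moreover have "norm (K o\<^sub>L toeplitz_op d) \<le> norm K * (\<Sum>\<^sub>\<infinity>k. cmod (d k))"
    by (intro bound norm_toeplitz_op d order_refl)
  moreover have "norm (?H o\<^sub>L ?G) \<le> (\<Sum>\<^sub>\<infinity>k. cmod (c k)) * (\<Sum>\<^sub>\<infinity>k. cmod (d k))"
    using norm_hankel_op[OF reflected_abs_summable[OF c]] norm_hankel_op[OF d]
    by (intro bound) (simp_all add: reflected_norm)
  ultimately show "norm M \<le> (\<Sum>\<^sub>\<infinity>k. cmod (c k)) * (\<Sum>\<^sub>\<infinity>k. cmod (d k)) + (\<Sum>\<^sub>\<infinity>k. cmod (c k)) * norm L
      + norm K * (\<Sum>\<^sub>\<infinity>k. cmod (d k)) + norm K * norm L"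
    using norm_blinfun_compose[of K L] by linarith
qed

text \<open>Coordinatewise limits, with the Cauchy estimate passed to the limit on finite sets of
indices, where it is a statement about finite sums.\<close>
lemma ell1_complete:
  fixes X :: "nat \<Rightarrow> int \<Rightarrow> complex"
  assumes X: "\<And>n. ell1 (X n)"
    and cauchy: "\<And>e. 0 < e \<Longrightarrow> \<exists>N. \<forall>m\<ge>N. \<forall>n\<ge>N. (\<Sum>\<^sub>\<infinity>k. cmod (X m k - X n k)) < e"
  obtains c where "ell1 c" "(\<lambda>n. \<Sum>\<^sub>\<infinity>k. cmod (X n k - c k)) \<longlonglongrightarrow> 0"
proof -
  have finite_le: "(\<Sum>k\<in>F. cmod (X m k - X n k)) \<le> (\<Sum>\<^sub>\<infinity>k. cmod (X m k - X n k))"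
    if "finite F" for F m n
    by (rule finite_sum_le_infsum) (auto intro: ell1_diff X that)
  have "Cauchy (\<lambda>n. X n k)" for k
  proof (rule CauchyI)
    fix e :: real
    assume "0 < e"
    with cauchy obtain N where N: "\<forall>m\<ge>N. \<forall>n\<ge>N. (\<Sum>\<^sub>\<infinity>k. cmod (X m k - X n k)) < e" by blast
    have "norm (X m k - X n k) < e" if "N \<le> m" "N \<le> n" for m n
      using finite_le[of "{k}" m n] N that by fastforce
    then show "\<exists>N. \<forall>m\<ge>N. \<forall>n\<ge>N. norm (X m k - X n k) < e" by blast
  qed
  then have "\<forall>k. \<exists>l. (\<lambda>n. X n k) \<longlonglongrightarrow> l"
    using Cauchy_convergent_iff convergent_def by blast
  then obtain c where c: "\<And>k. (\<lambda>n. X n k) \<longlonglongrightarrow> c k" by metis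
  have tail: "\<exists>N. \<forall>m\<ge>N. \<forall>F. finite F \<longrightarrow> (\<Sum>k\<in>F. cmod (X m k - c k)) \<le> e" if e: "0 < e" for e
  proof -
    from cauchy[OF e] obtain N
      where N: "\<forall>m\<ge>N. \<forall>n\<ge>N. (\<Sum>\<^sub>\<infinity>k. cmod (X m k - X n k)) < e" by blast
    have "(\<Sum>k\<in>F. cmod (X m k - c k)) \<le> e" if m: "N \<le> m" and F: "finite F" for m F
    proof (rule LIMSEQ_le_const2)
      show "(\<lambda>n. \<Sum>k\<in>F. cmod (X m k - X n k)) \<longlonglongrightarrow> (\<Sum>k\<in>F. cmod (X m k - c k))"
        by (intro tendsto_intros c)
      have "(\<Sum>k\<in>F. cmod (X m k - X n k)) \<le> e" if "N \<le> n" for n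
        using finite_le[OF F, of m n] N m that by fastforce
      then show "\<exists>N. \<forall>n\<ge>N. (\<Sum>k\<in>F. cmod (X m k - X n k)) \<le> e" by blast
    qed
    then show ?thesis by blast
  qed
  have diff: "ell1 (\<lambda>k. X m k - c k)"
    if "\<forall>F. finite F \<longrightarrow> (\<Sum>k\<in>F. cmod (X m k - c k)) \<le> e" for m e
    by (rule nonneg_bdd_above_summable_on) (use that in \<open>auto intro!: bdd_aboveI2\<close>)
  obtain m where "\<forall>F. finite F \<longrightarrow> (\<Sum>k\<in>F. cmod (X m k - c k)) \<le> 1"
    using tail[of 1] by auto
  from ell1_diff[OF X[of m] diff[OF this]] have "ell1 c" by simp
  moreover have "(\<lambda>n. \<Sum>\<^sub>\<infinity>k. cmod (X n k - c k)) \<longlonglongrightarrow> 0"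
  proof (rule LIMSEQ_I)
    fix e :: real
    assume e: "0 < e"
    then obtain N where N: "\<And>m F. N \<le> m \<Longrightarrow> finite F \<Longrightarrow> (\<Sum>k\<in>F. cmod (X m k - c k)) \<le> e/2"
      using tail[of "e/2"] by auto
    have "(\<Sum>\<^sub>\<infinity>k. cmod (X n k - c k)) \<le> e/2" if "N \<le> n" for n
      by (rule infsum_le_finite_sums[OF ell1_diff[OF X \<open>ell1 c\<close>]]) (use N[OF that] in auto)
    then have "norm ((\<Sum>\<^sub>\<infinity>k. cmod (X n k - c k)) - 0) < e" if "N \<le> n" for n
      using that e by (simp add: infsum_nonneg) force
    then show "\<exists>N. \<forall>n\<ge>N. norm ((\<Sum>\<^sub>\<infinity>k. cmod (X n k - c k)) - 0) < e" by blast
  qed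
  ultimately show ?thesis by (rule that)
qed

lemma qt_norm_diff:
  assumes "ell1 c" "ell1 d" "K \<in> compact_linear_ops" "L \<in> compact_linear_ops"
  shows "qt_norm \<alpha> (matrix_of (qt_op c K) - matrix_of (qt_op d L))
    = \<alpha> * (\<Sum>\<^sub>\<infinity>k. cmod (c k - d k)) + norm (K - L)"
  unfolding matrix_of_diff[symmetric] qt_op_diff[OF assms(1,2)]
  by (intro qt_norm_matrix_of ell1_diff compact_linear_ops_diff assms)

lemma qt_norm_complete:
  assumes \<alpha>: "0 < \<alpha>" and X: "range X \<subseteq> QT"
    and cauchy: "\<forall>e>0. \<exists>N. \<forall>m\<ge>N. \<forall>n\<ge>N. qt_norm \<alpha> (X m - X n) < e"
  shows "\<exists>A\<in>QT. (\<lambda>n. qt_norm \<alpha> (X n - A)) \<longlonglongrightarrow> 0"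
proof -
  have "\<exists>c K. ell1 c \<and> K \<in> compact_linear_ops \<and> X n = matrix_of (qt_op c K)" for n
    using X QT_E[of "X n"] by (metis rangeI subsetD)
  then obtain c K where c: "\<And>n. ell1 (c n)" and K: "\<And>n. K n \<in> compact_linear_ops"
    and X_eq: "\<And>n. X n = matrix_of (qt_op (c n) (K n))"
    by metis
  have norm_eq: "qt_norm \<alpha> (X m - X n) = \<alpha> * (\<Sum>\<^sub>\<infinity>k. cmod (c m k - c n k)) + norm (K m - K n)" for m n
    by (simp add: X_eq qt_norm_diff c K)
  have nonneg: "0 \<le> \<alpha> * (\<Sum>\<^sub>\<infinity>k. cmod (c m k - c n k))" for m n
    using \<alpha> by (simp add: infsum_nonneg)
  obtain d where d: "ell1 d" and lim_d: "(\<lambda>n. \<Sum>\<^sub>\<infinity>k. cmod (c n k - d k)) \<longlonglongrightarrow> 0"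
  proof (rule ell1_complete[OF c])
    fix e :: real
    assume "0 < e"
    with \<alpha> cauchy obtain N where N: "\<forall>m\<ge>N. \<forall>n\<ge>N. qt_norm \<alpha> (X m - X n) < \<alpha> * e"
      by (meson mult_pos_pos)
    have "(\<Sum>\<^sub>\<infinity>k. cmod (c m k - c n k)) < e" if "N \<le> m" "N \<le> n" for m n
    proof -
      have "\<alpha> * (\<Sum>\<^sub>\<infinity>k. cmod (c m k - c n k)) \<le> qt_norm \<alpha> (X m - X n)"
        by (simp add: norm_eq)
      also have "\<dots> < \<alpha> * e" using N that by blast
      finally show ?thesis using \<alpha> by simp
    qed
    then show "\<exists>N. \<forall>m\<ge>N. \<forall>n\<ge>N. (\<Sum>\<^sub>\<infinity>k. cmod (c m k - c n k)) < e" by blast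
  qed
  have "Cauchy K"
  proof (rule CauchyI)
    fix e :: real
    assume "0 < e"
    with cauchy obtain N where N: "\<forall>m\<ge>N. \<forall>n\<ge>N. qt_norm \<alpha> (X m - X n) < e" by blast
    have "norm (K m - K n) < e" if "N \<le> m" "N \<le> n" for m n
    proof -
      have "norm (K m - K n) \<le> qt_norm \<alpha> (X m - X n)" using nonneg[of m n] by (simp add: norm_eq)
      also have "\<dots> < e" using N that by blast
      finally show ?thesis .
    qed
    then show "\<exists>N. \<forall>m\<ge>N. \<forall>n\<ge>N. norm (K m - K n) < e" by blast
  qed
  then obtain L where lim_L: "K \<longlonglongrightarrow> L" using Cauchy_convergent_iff convergent_def by blast
  have L: "L \<in> compact_linear_ops"
    using closed_sequentially[OF closed_compact_linear_ops] K lim_L by blast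
  have "(\<lambda>n. \<alpha> * (\<Sum>\<^sub>\<infinity>k. cmod (c n k - d k)) + norm (K n - L)) \<longlonglongrightarrow> \<alpha> * 0 + 0"
    by (intro tendsto_intros lim_d tendsto_norm_zero LIM_zero lim_L)
  then have "(\<lambda>n. qt_norm \<alpha> (X n - matrix_of (qt_op d L))) \<longlonglongrightarrow> 0"
    by (simp add: X_eq qt_norm_diff c K d L)
  with QT_I[OF d L] show ?thesis by blast
qed

text \<open>The Wiener norms of the two factors multiply with weight \<open>\<alpha>\<close> from the convolution and with
weight 1 from the Hankel term, while the product of the norms provides \<open>\<alpha>\<^sup>2\<close>. This is the
origin of the condition \<open>\<alpha> + 1 \<le> \<alpha>\<^sup>2\<close>, of which the golden ratio is the least positive
solution. The mixed terms only need \<open>1 \<le> \<alpha>\<close>.\<close>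
lemma qt_norm_submultiplicative:
  assumes \<alpha>: "1 \<le> \<alpha>" "\<alpha> + 1 \<le> \<alpha>\<^sup>2" and "A \<in> QT" "B \<in> QT"
  shows "mat_mult A B \<in> QT" "qt_norm \<alpha> (mat_mult A B) \<le> qt_norm \<alpha> A * qt_norm \<alpha> B"
proof -
  from \<open>A \<in> QT\<close> obtain c K where c: "ell1 c" and K: "K \<in> compact_linear_ops"
    and A: "A = matrix_of (qt_op c K)" by (rule QT_E)
  from \<open>B \<in> QT\<close> obtain d L where d: "ell1 d" and L: "L \<in> compact_linear_ops"
    and B: "B = matrix_of (qt_op d L)" by (rule QT_E)
  define p q where "p = (\<Sum>\<^sub>\<infinity>k. cmod (c k))" and "q = (\<Sum>\<^sub>\<infinity>k. cmod (d k))"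
  obtain M where M: "M \<in> compact_linear_ops" "qt_op c K o\<^sub>L qt_op d L = qt_op (convolution c d) M"
    and norm_M: "norm M \<le> p * q + p * norm L + norm K * q + norm K * norm L"
    unfolding p_def q_def by (rule qt_op_compose[OF c d K L])
  have mult: "mat_mult A B = matrix_of (qt_op (convolution c d) M)"
    by (simp add: A B mat_mult_matrix_of complex_linear_qt_op c K M(2))
  then show "mat_mult A B \<in> QT" by (simp add: QT_I convolution_abs_summable c d M(1))
  have pq: "0 \<le> p" "0 \<le> q" by (simp_all add: p_def q_def infsum_nonneg)
  have "qt_norm \<alpha> (mat_mult A B) = \<alpha> * (\<Sum>\<^sub>\<infinity>k. cmod (convolution c d k)) + norm M"
    by (simp add: mult qt_norm_matrix_of convolution_abs_summable c d M(1))
  also have "\<dots> \<le> \<alpha> * (p * q) + (p * q + p * norm L + norm K * q + norm K * norm L)"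
    using convolution_norm_le[OF c d] \<alpha>(1) norm_M
    by (intro add_mono mult_left_mono) (auto simp: p_def q_def)
  also have "\<dots> = (\<alpha> + 1) * (p * q) + 1 * (p * norm L) + 1 * (norm K * q) + norm K * norm L"
    by (simp add: algebra_simps)
  also have "\<dots> \<le> \<alpha>\<^sup>2 * (p * q) + \<alpha> * (p * norm L) + \<alpha> * (norm K * q) + norm K * norm L"
    using \<alpha> pq by (intro add_mono mult_right_mono) auto
  also have "\<dots> = (\<alpha> * p + norm K) * (\<alpha> * q + norm L)"
    by (simp add: algebra_simps power2_eq_square)
  also have "\<dots> = qt_norm \<alpha> A * qt_norm \<alpha> B"
    by (simp add: A B qt_norm_matrix_of c d K L p_def q_def)
  finally show "qt_norm \<alpha> (mat_mult A B) \<le> qt_norm \<alpha> A * qt_norm \<alpha> B" .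
qed

lemma zero_eq_qt_op: "0 = matrix_of (qt_op (\<lambda>_. 0) 0)"
  using qt_op_diff[OF ell1_one ell1_one, of 0 0] by (simp flip: matrix_of_0)

lemma QT_zero: "0 \<in> QT"
  unfolding zero_eq_qt_op by (intro QT_I compact_linear_ops_0) simp

lemma QT_add:
  assumes "A \<in> QT" "B \<in> QT"
  shows "A + B \<in> QT"
    and qt_norm_triangle: "0 \<le> \<alpha> \<Longrightarrow> qt_norm \<alpha> (A + B) \<le> qt_norm \<alpha> A + qt_norm \<alpha> B"
proof -
  from assms obtain c K d L where c: "ell1 c" and K: "K \<in> compact_linear_ops"
    and A: "A = matrix_of (qt_op c K)" and d: "ell1 d" and L: "L \<in> compact_linear_ops"
    and B: "B = matrix_of (qt_op d L)" by (elim QT_E)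
  have sum: "A + B = matrix_of (qt_op (\<lambda>k. c k + d k) (K + L))"
    unfolding A B matrix_of_add[symmetric] by (simp add: qt_op_add c d)
  show "A + B \<in> QT"
    unfolding sum by (intro QT_I ell1_add compact_linear_ops_add c d K L)
  assume \<alpha>: "0 \<le> \<alpha>"
  have "(\<Sum>\<^sub>\<infinity>k. cmod (c k + d k)) \<le> (\<Sum>\<^sub>\<infinity>k. cmod (c k) + cmod (d k))"
    by (intro infsum_mono ell1_add summable_on_add c d norm_triangle_ineq)
  also have "\<dots> = (\<Sum>\<^sub>\<infinity>k. cmod (c k)) + (\<Sum>\<^sub>\<infinity>k. cmod (d k))"
    by (intro infsum_add c d)
  finally have "\<alpha> * (\<Sum>\<^sub>\<infinity>k. cmod (c k + d k)) \<le> \<alpha> * ((\<Sum>\<^sub>\<infinity>k. cmod (c k)) + (\<Sum>\<^sub>\<infinity>k. cmod (d k)))"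
    using \<alpha> by (rule mult_left_mono)
  then have "\<alpha> * (\<Sum>\<^sub>\<infinity>k. cmod (c k + d k)) + norm (K + L)
      \<le> (\<alpha> * (\<Sum>\<^sub>\<infinity>k. cmod (c k)) + norm K) + (\<alpha> * (\<Sum>\<^sub>\<infinity>k. cmod (d k)) + norm L)"
    using norm_triangle_ineq[of K L] by (simp add: distrib_left)
  then show "qt_norm \<alpha> (A + B) \<le> qt_norm \<alpha> A + qt_norm \<alpha> B"
    unfolding sum unfolding A B
    by (simp add: qt_norm_matrix_of ell1_add compact_linear_ops_add c d K L)
qed

lemma QT_scale:
  assumes "A \<in> QT"
  shows "mat_scale z A \<in> QT"
    and qt_norm_scale: "qt_norm \<alpha> (mat_scale z A) = cmod z * qt_norm \<alpha> A"
proof -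
  from assms obtain c K where c: "ell1 c" and K: "K \<in> compact_linear_ops"
    and A: "A = matrix_of (qt_op c K)" by (elim QT_E)
  have scale: "mat_scale z A = matrix_of (qt_op (\<lambda>k. z * c k) (cmulL z o\<^sub>L K))"
    unfolding A matrix_of_cmulL[symmetric] by (simp add: qt_op_scale c)
  have zK: "cmulL z o\<^sub>L K \<in> compact_linear_ops"
    by (intro compact_linear_ops_compose_left complex_linear_cmulL K)
  show "mat_scale z A \<in> QT"
    unfolding scale by (rule QT_I[OF ell1_scale[OF c] zK])
  show "qt_norm \<alpha> (mat_scale z A) = cmod z * qt_norm \<alpha> A"
    unfolding scale qt_norm_matrix_of[OF ell1_scale[OF c] zK]
    unfolding A qt_norm_matrix_of[OF c K]
    by (simp add: norm_mult infsum_cmult_right' norm_cmulL_compose algebra_simps)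
qed

lemma qt_norm_nonneg: "0 \<le> \<alpha> \<Longrightarrow> A \<in> QT \<Longrightarrow> 0 \<le> qt_norm \<alpha> A"
  by (elim QT_E) (simp add: qt_norm_matrix_of infsum_nonneg)

lemma qt_norm_eq_0_iff:
  assumes "0 < \<alpha>" "A \<in> QT"
  shows "qt_norm \<alpha> A = 0 \<longleftrightarrow> A = 0"
proof
  from assms(2) obtain c K where c: "ell1 c" and K: "K \<in> compact_linear_ops"
    and A: "A = matrix_of (qt_op c K)" by (elim QT_E)
  assume "qt_norm \<alpha> A = 0"
  then have eq: "\<alpha> * (\<Sum>\<^sub>\<infinity>k. cmod (c k)) + norm K = 0" by (simp add: A qt_norm_matrix_of c K)
  have nonneg: "0 \<le> (\<Sum>\<^sub>\<infinity>k. cmod (c k))" by (simp add: infsum_nonneg)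
  with assms(1) have "0 \<le> \<alpha> * (\<Sum>\<^sub>\<infinity>k. cmod (c k))" by simp
  with eq have "\<alpha> * (\<Sum>\<^sub>\<infinity>k. cmod (c k)) = 0" and K0: "norm K = 0"
    using norm_ge_zero[of K] by linarith+
  with assms(1) have "(\<Sum>\<^sub>\<infinity>k. cmod (c k)) \<le> 0" by simp
  then have "cmod (c k) = 0" for k by (rule nonneg_infsum_le_0D) (auto simp: c)
  then have "c = (\<lambda>_. 0)" by (simp add: fun_eq_iff)
  with K0 zero_eq_qt_op A show "A = 0" by simp
next
  assume "A = 0"
  then show "qt_norm \<alpha> A = 0"
    unfolding zero_eq_qt_op by (simp add: qt_norm_matrix_of compact_linear_ops_0)
qed

theorem mainTheorem1:
  fixes \<alpha> :: real
  assumes "\<alpha> = (1 + sqrt 5) / 2"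
  shows "(\<forall>A\<in>QT. \<forall>B\<in>QT. \<forall>i j. summable (\<lambda>k. A i k * B k j)) \<and>
    banach_algebra_on mat_scale QT mat_mult mat_one (qt_norm \<alpha>)"
proof
  have sq: "\<alpha> + 1 \<le> \<alpha>\<^sup>2" unfolding assms power2_eq_square by (simp add: field_simps)
  have "(1 + 1) / 2 \<le> \<alpha>" unfolding assms by (intro divide_right_mono add_left_mono) simp_all
  then have ge1: "1 \<le> \<alpha>" by simp
  have rep: "\<exists>T. complex_linear T \<and> A = matrix_of T" if "A \<in> QT" for A
    using that by (elim QT_E) (auto intro: complex_linear_qt_op)
  show "\<forall>A\<in>QT. \<forall>B\<in>QT. \<forall>i j. summable (\<lambda>k. A i k * B k j)"
    using rep matrix_of_compose sums_summable by metis
  interpret vector_space mat_scale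
    by unfold_locales (auto simp: mat_scale_def fun_eq_iff algebra_simps)
  show "banach_algebra_on mat_scale QT mat_mult mat_one (qt_norm \<alpha>)"
  proof (unfold_locales, goal_cases)
    case 1
    show ?case
      by (intro subspaceI QT_zero QT_add QT_scale)
  next
    case (2 A B)
    then show ?case by (rule qt_norm_submultiplicative(1)[OF ge1 sq])
  next
    case (3 A B C)
    then obtain R S T where "complex_linear R" "complex_linear S" "complex_linear T"
      "A = matrix_of R" "B = matrix_of S" "C = matrix_of T"
      using rep by metis
    then show ?case
      by (simp add: mat_mult_matrix_of complex_linear_compose blinfun_compose_assoc)
  next
    case (4 A B C)
    then obtain R S T where "complex_linear R" "complex_linear S" "complex_linear T"
      "A = matrix_of R" "B = matrix_of S" "C = matrix_of T"
      using rep by metis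
    then show ?case
      by (simp add: mat_mult_matrix_of complex_linear_add flip: matrix_of_add)
        (simp add: matrix_of_add mat_mult_matrix_of
          bounded_bilinear.add_left[OF bounded_bilinear_blinfun_compose])
  next
    case (5 A B C)
    then obtain R S T where "complex_linear R" "complex_linear S" "complex_linear T"
      "A = matrix_of R" "B = matrix_of S" "C = matrix_of T"
      using rep by metis
    then show ?case
      by (simp add: mat_mult_matrix_of flip: matrix_of_add)
        (simp add: bounded_bilinear.add_right[OF bounded_bilinear_blinfun_compose])
  next
    case (6 z A B)
    then obtain S T where "complex_linear S" "complex_linear T"
      "A = matrix_of S" "B = matrix_of T"
      using rep by metis
    then show ?case
      by (simp add: mat_mult_matrix_of complex_linear_compose complex_linear_cmulL
          blinfun_compose_assoc flip: matrix_of_cmulL)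
  next
    case (7 z A B)
    then obtain S T where S: "complex_linear S" and "complex_linear T"
      "A = matrix_of S" "B = matrix_of T"
      using rep by metis
    moreover have "S o\<^sub>L (cmulL z o\<^sub>L T) = cmulL z o\<^sub>L (S o\<^sub>L T)"
      using S by (intro blinfun_eqI) (simp add: complex_linear_def)
    ultimately show ?case
      by (simp add: mat_mult_matrix_of flip: matrix_of_cmulL)
  next
    case 8
    show ?case
      unfolding matrix_of_id[symmetric] qt_op_one by (intro QT_I ell1_one compact_linear_ops_0)
  next
    case (9 A)
    then obtain T where "A = matrix_of T" using rep by blast
    moreover have "id_blinfun o\<^sub>L T = T" by (intro blinfun_eqI) simp
    ultimately show ?case
      by (simp add: mat_mult_matrix_of complex_linear_id flip: matrix_of_id)
  next
    case (10 A)
    then obtain T where "complex_linear T" "A = matrix_of T" using rep by blast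
    moreover have "T o\<^sub>L id_blinfun = T" by (intro blinfun_eqI) simp
    ultimately show ?case
      by (simp add: mat_mult_matrix_of flip: matrix_of_id)
  next
    case (11 A)
    then show ?case using ge1 by (simp add: qt_norm_nonneg)
  next
    case (12 A)
    then show ?case using ge1 by (simp add: qt_norm_eq_0_iff)
  next
    case (13 z A)
    then show ?case by (rule qt_norm_scale)
  next
    case (14 A B)
    then show ?case using ge1 by (simp add: qt_norm_triangle)
  next
    case (15 A B)
    then show ?case by (rule qt_norm_submultiplicative(2)[OF ge1 sq])
  next
    case (16 X)
    then show ?case using ge1 by (intro qt_norm_complete) auto
  qed
qed

end
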